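(* Let $E$ be a finite directed graph without sinks, and let $u\in\mathcal U_E$ be a unitary in $\mathcal F_E^k$ for some $k\ge1$. Then the following conditions are equivalent: (1) $\lambda_u$ is invertible with localized inverse; (2) the sequence of unitaries $\{\mathrm{Ad}(u_m^* )(u^* )\}_{m\ge1}$ eventually stabilizes (i.e. is constant from some $m$ on); (3) the ring $A_u$ is nilpotent; (4) $\Xi_u\subseteq\mathcal D_E^0$.
   Context: A directed graph $E=(E^0,E^1,r,s)$ has vertex set $E^0$, edge set $E^1$, and range and source maps $r,s:E^1\to E^0$; it is finite if $E^0$ and $E^1$ are finite. A sink is a vertex emitting no edges. $C^*(E)$ is the universal $C^*$-algebra generated by mutually orthogonal projections $P_v$ ($v\in E^0$) and partial isometries $S_e$ ($e\in E^1$) with $S_e^*S_e=P_{r(e)}$, $S_e^*S_f=0$ for $e\ne f$, $S_eS_e^*\le P_{s(e)}$, and $P_v=\sum_{s(e)=v}S_eS_e^*$ whenever $v$ emits finitely many and at least one edge. A path of length $k\ge1$ is $\mu=(\mu_1,\ldots,\mu_k)$ with $\mu_j\in E^1$ and $r(\mu_j)=s(\mu_{j+1})$; vertices are the paths of length $0$; put $|\mu|$ for the length, $S_\mu=S_{\mu_1}\cdots S_{\mu_k}$, $S_v=P_v$. $\mathcal F_E^k$ is the linear span of $\{S_\mu S_\nu^*:|\mu|=|\nu|=k\}$ and $\mathcal D_E^0=\mathrm{span}\{P_v:v\in E^0\}$. $\mathcal U_E$ is the group of unitaries in $C^*(E)$ commuting with all $P_v$. For $u\in\mathcal U_E$, $\lambda_u$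 is the unital $*$-endomorphism of $C^*(E)$ with $\lambda_u(S_e)=uS_e$, $\lambda_u(P_v)=P_v$. It is invertible if it is an automorphism of $C^*(E)$; an endomorphism is localized if it equals $\lambda_w$ for some $w\in\mathcal F_E^l\cap\mathcal U_E$ and some $l$. The shift is $\varphi(x)=\sum_{e\in E^1}S_exS_e^*$; $u_m=u\varphi(u)\cdots\varphi^{m-1}(u)$, $u_m^*=(u_m)^*$, and $\mathrm{Ad}(w)(x)=wxw^*$. For a unitary $u\in\mathcal F_E^k\cap\mathcal U_E$ and $e,f\in E^1$ define the linear map $a^u_{e,f}:\mathcal F_E^{k-1}\to\mathcal F_E^{k-1}$ by $a^u_{e,f}(x)=S_e^*u^*xuS_f$. It maps $\mathcal D_E^0$ into itself, hence induces $\tilde a^u_{e,f}$ on the quotient vector space $V_k=\mathcal F_E^{k-1}/\mathcal D_E^0$. $A_u$ is the (not necessarily unital) subring of the ring $\mathcal L(V_k)$ of linear maps on $V_k$ generated by $\{\tilde a^u_{e,f}:e,f\in E^1\}$; it is nilpotent if $A_u^l=\{0\}$ for some $l$. Let $H$ be the linear span of $\{S_e:e\in E^1\}$. Define $\Xi_0=\mathcal F_E^{k-1}$ and, for $r\ge1$, $\Xi_r=\lambda_u(H)^*\Xi_{r-1}\lambda_u(H)$ (linear span of such products), a non-increasing sequence of subspaces of $\mathcal F_E^{k-1}$, and $\Xi_u=\bigcap_{r\ge0}\Xi_r$. *)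

theory Defs
  imports
    "HOL-Analysis.Analysis"
    "HOL-Library.Set_Algebras"
    "HOL-Algebra.Ideal_Product"
    "Graph_Theory.Arc_Walk"
begin

section \<open>C*-algebras\<close>

text \<open>Neither class requires a unit; in particular the zero algebra is an instance of both.\<close>

class star_algebra = Rings.ring +
  fixes scaleC :: "complex \<Rightarrow> 'a \<Rightarrow> 'a" (infixr "*\<^sub>C" 75)
    and star :: "'a \<Rightarrow> 'a"
  assumes scaleC_add_right: "a *\<^sub>C (x + y) = a *\<^sub>C x + a *\<^sub>C y"
    and scaleC_add_left: "(a + b) *\<^sub>C x = a *\<^sub>C x + b *\<^sub>C x"
    and scaleC_scaleC: "a *\<^sub>C (b *\<^sub>C x) = (a * b) *\<^sub>C x"
    and scaleC_one: "1 *\<^sub>C x = x"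
    and mult_scaleC_left: "(a *\<^sub>C x) * y = a *\<^sub>C (x * y)"
    and mult_scaleC_right: "x * (a *\<^sub>C y) = a *\<^sub>C (x * y)"
    and star_add: "star (x + y) = star x + star y"
    and star_scaleC: "star (a *\<^sub>C x) = cnj a *\<^sub>C star x"
    and star_mult: "star (x * y) = star y * star x"
    and star_star: "star (star x) = x"

class cstar_algebra = star_algebra + real_normed_algebra + banach +
  assumes scaleR_scaleC: "r *\<^sub>R x = complex_of_real r *\<^sub>C x"
    and norm_scaleC: "norm (a *\<^sub>C x) = cmod a * norm x"
    and norm_star_mult: "norm (star x * x) = (norm x)\<^sup>2"

global_interpretation complex_vector: vector_space "scaleC :: complex \<Rightarrow> 'a \<Rightarrow> 'a::star_algebra"
  defines cspan = complex_vector.span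
  by unfold_locales (simp_all add: scaleC_add_right scaleC_add_left scaleC_scaleC scaleC_one)

inductive_set star_subalgebra :: "'a::star_algebra set \<Rightarrow> 'a set" for X where
  incl: "x \<in> X \<Longrightarrow> x \<in> star_subalgebra X"
| zero: "0 \<in> star_subalgebra X"
| add: "x \<in> star_subalgebra X \<Longrightarrow> y \<in> star_subalgebra X \<Longrightarrow> x + y \<in> star_subalgebra X"
| scale: "x \<in> star_subalgebra X \<Longrightarrow> c *\<^sub>C x \<in> star_subalgebra X"
| mult: "x \<in> star_subalgebra X \<Longrightarrow> y \<in> star_subalgebra X \<Longrightarrow> x * y \<in> star_subalgebra X"
| star: "x \<in> star_subalgebra X \<Longrightarrow> star x \<in> star_subalgebra X"

definition star_hom :: "('a::star_algebra \<Rightarrow> 'b::star_algebra) \<Rightarrow> bool" where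
  "star_hom h \<longleftrightarrow>
     (\<forall>x y. h (x + y) = h x + h y) \<and> (\<forall>c x. h (c *\<^sub>C x) = c *\<^sub>C h x) \<and>
     (\<forall>x y. h (x * y) = h x * h y) \<and> (\<forall>x. h (star x) = star (h x))"

definition cstar_seminorm :: "('a::star_algebra \<Rightarrow> real) \<Rightarrow> bool" where
  "cstar_seminorm p \<longleftrightarrow>
     (\<forall>x y. p (x + y) \<le> p x + p y) \<and> (\<forall>c x. p (c *\<^sub>C x) = cmod c * p x) \<and>
     (\<forall>x y. p (x * y) \<le> p x * p y) \<and> (\<forall>x. p (star x * x) = (p x)\<^sup>2)"

definition is_identity :: "'a::star_algebra \<Rightarrow> bool" where
  "is_identity e \<longleftrightarrow> (\<forall>x. e * x = x \<and> x * e = x)"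

definition unitary :: "'a::star_algebra \<Rightarrow> bool" where
  "unitary u \<longleftrightarrow> is_identity (star u * u) \<and> is_identity (u * star u)"

definition Ad :: "'a::star_algebra \<Rightarrow> 'a \<Rightarrow> 'a" where
  "Ad w x = w * x * star w"


section \<open>The free *-algebra\<close>

datatype 'g star_term =
    TGen 'g
  | TZero
  | TAdd "'g star_term" "'g star_term"
  | TMult "'g star_term" "'g star_term"
  | TScale complex "'g star_term"
  | TStar "'g star_term"

inductive star_eq :: "'g star_term \<Rightarrow> 'g star_term \<Rightarrow> bool" where
  refl: "star_eq a a"
| sym: "star_eq a b \<Longrightarrow> star_eq b a"
| trans: "star_eq a b \<Longrightarrow> star_eq b c \<Longrightarrow> star_eq a c"
| cong_add: "star_eq a a' \<Longrightarrow> star_eq b b' \<Longrightarrow> star_eq (TAdd a b) (TAdd a' b')"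
| cong_mult: "star_eq a a' \<Longrightarrow> star_eq b b' \<Longrightarrow> star_eq (TMult a b) (TMult a' b')"
| cong_scale: "star_eq a a' \<Longrightarrow> star_eq (TScale x a) (TScale x a')"
| cong_star: "star_eq a a' \<Longrightarrow> star_eq (TStar a) (TStar a')"
| add_assoc: "star_eq (TAdd (TAdd a b) c) (TAdd a (TAdd b c))"
| add_comm: "star_eq (TAdd a b) (TAdd b a)"
| add_zero: "star_eq (TAdd TZero a) a"
| add_inv: "star_eq (TAdd (TScale (-1) a) a) TZero"
| mult_assoc: "star_eq (TMult (TMult a b) c) (TMult a (TMult b c))"
| distrib_right: "star_eq (TMult (TAdd a b) c) (TAdd (TMult a c) (TMult b c))"
| distrib_left: "star_eq (TMult a (TAdd b c)) (TAdd (TMult a b) (TMult a c))"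
| scale_add_right: "star_eq (TScale x (TAdd a b)) (TAdd (TScale x a) (TScale x b))"
| scale_add_left: "star_eq (TScale (x + y) a) (TAdd (TScale x a) (TScale y a))"
| scale_scale: "star_eq (TScale x (TScale y a)) (TScale (x * y) a)"
| scale_one: "star_eq (TScale 1 a) a"
| mult_scale_left: "star_eq (TMult (TScale x a) b) (TScale x (TMult a b))"
| mult_scale_right: "star_eq (TMult a (TScale x b)) (TScale x (TMult a b))"
| star_add: "star_eq (TStar (TAdd a b)) (TAdd (TStar a) (TStar b))"
| star_scale: "star_eq (TStar (TScale x a)) (TScale (cnj x) (TStar a))"
| star_mult: "star_eq (TStar (TMult a b)) (TMult (TStar b) (TStar a))"
| star_star: "star_eq (TStar (TStar a)) a"

quotient_type 'g free_star_algebra = "'g star_term" / star_eq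
  by (intro equivpI reflpI sympI transpI) (blast intro: star_eq.refl star_eq.sym star_eq.trans)+

instantiation free_star_algebra :: (type) star_algebra
begin

lift_definition zero_free_star_algebra :: "'a free_star_algebra" is TZero .
lift_definition plus_free_star_algebra ::
  "'a free_star_algebra \<Rightarrow> 'a free_star_algebra \<Rightarrow> 'a free_star_algebra"
  is TAdd by (rule star_eq.cong_add)
lift_definition times_free_star_algebra ::
  "'a free_star_algebra \<Rightarrow> 'a free_star_algebra \<Rightarrow> 'a free_star_algebra"
  is TMult by (rule star_eq.cong_mult)
lift_definition uminus_free_star_algebra :: "'a free_star_algebra \<Rightarrow> 'a free_star_algebra"
  is "TScale (-1)" by (rule star_eq.cong_scale)
lift_definition minus_free_star_algebra ::
  "'a free_star_algebra \<Rightarrow> 'a free_star_algebra \<Rightarrow> 'a free_star_algebra"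
  is "\<lambda>a b. TAdd a (TScale (-1) b)" by (intro star_eq.cong_add star_eq.cong_scale)
lift_definition scaleC_free_star_algebra ::
  "complex \<Rightarrow> 'a free_star_algebra \<Rightarrow> 'a free_star_algebra"
  is TScale by (rule star_eq.cong_scale)
lift_definition star_free_star_algebra :: "'a free_star_algebra \<Rightarrow> 'a free_star_algebra"
  is TStar by (rule star_eq.cong_star)

instance
  by standard (transfer, rule star_eq.add_assoc star_eq.add_comm star_eq.add_zero star_eq.add_inv
    star_eq.mult_assoc star_eq.distrib_right star_eq.distrib_left star_eq.scale_add_right
    star_eq.scale_add_left star_eq.scale_scale star_eq.scale_one star_eq.mult_scale_left
    star_eq.mult_scale_right star_eq.star_add star_eq.star_scale star_eq.star_mult
    star_eq.star_star star_eq.refl)+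

end

lift_definition free_gen :: "'g \<Rightarrow> 'g free_star_algebra" is TGen .

primrec term_eval :: "('g \<Rightarrow> 'a::star_algebra) \<Rightarrow> 'g star_term \<Rightarrow> 'a" where
  "term_eval g (TGen x) = g x"
| "term_eval g TZero = 0"
| "term_eval g (TAdd a b) = term_eval g a + term_eval g b"
| "term_eval g (TMult a b) = term_eval g a * term_eval g b"
| "term_eval g (TScale c a) = c *\<^sub>C term_eval g a"
| "term_eval g (TStar a) = star (term_eval g a)"

lemma scaleC_minus_one: "(- 1) *\<^sub>C x = - (x :: 'a::star_algebra)"
  using complex_vector.scale_minus_left[of 1 x] by (simp add: scaleC_one)

lift_definition free_eval :: "('g \<Rightarrow> 'a::star_algebra) \<Rightarrow> 'g free_star_algebra \<Rightarrow> 'a"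
  is term_eval
proof -
  fix g :: "'g \<Rightarrow> 'a" and a b :: "'g star_term"
  assume "star_eq a b"
  then show "term_eval g a = term_eval g b"
    by induction (simp_all add: algebra_simps star_algebra_class.scaleC_add_right
      star_algebra_class.scaleC_add_left star_algebra_class.scaleC_scaleC
      star_algebra_class.scaleC_one star_algebra_class.mult_scaleC_left
      star_algebra_class.mult_scaleC_right star_algebra_class.star_add
      star_algebra_class.star_scaleC star_algebra_class.star_mult star_algebra_class.star_star
      scaleC_minus_one)
qed

lemma free_eval_gen: "free_eval g (free_gen x) = g x"
  by transfer simp

lemma star_hom_free_eval: "star_hom (free_eval g)"
  unfolding star_hom_def by (intro conjI allI; transfer; simp)


section \<open>Graph C*-algebras\<close>

text \<open>
  Here \<^term>\<open>tail E\<close> is the source map and \<^term>\<open>head E\<close> the range map. The Cuntz-Krieger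
  relations are stated up to a relation \<^term>\<open>R\<close>, which is equality for families in a C*-algebra,
  and equality modulo the kernel of a seminorm for the generators of the free *-algebra. The
  inequality \<open>S e * star (S e) \<le> P (tail E e)\<close> is the order of projections:
  \<open>p \<le> q\<close> iff \<open>q p = p\<close>.
\<close>

definition ck_relations ::
  "('b \<Rightarrow> 'b \<Rightarrow> bool) \<Rightarrow> ('v, 'e) pre_digraph \<Rightarrow> ('v \<Rightarrow> 'b::star_algebra) \<Rightarrow> ('e \<Rightarrow> 'b) \<Rightarrow> bool"
where
  "ck_relations R E P S \<longleftrightarrow>
     (\<forall>v\<in>verts E. R (star (P v)) (P v) \<and> R (P v * P v) (P v)) \<and>
     (\<forall>v\<in>verts E. \<forall>w\<in>verts E. v \<noteq> w \<longrightarrow> R (P v * P w) 0) \<and>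
     (\<forall>e\<in>arcs E. R (S e * star (S e) * S e) (S e)) \<and>
     (\<forall>e\<in>arcs E. R (star (S e) * S e) (P (head E e))) \<and>
     (\<forall>e\<in>arcs E. \<forall>f\<in>arcs E. e \<noteq> f \<longrightarrow> R (star (S e) * S f) 0) \<and>
     (\<forall>e\<in>arcs E. R (P (tail E e) * (S e * star (S e))) (S e * star (S e))) \<and>
     (\<forall>v\<in>verts E. finite (out_arcs E v) \<and> out_arcs E v \<noteq> {} \<longrightarrow>
        R (P v) (\<Sum>e\<in>out_arcs E v. S e * star (S e)))"

abbreviation ck_family ::
  "('v, 'e) pre_digraph \<Rightarrow> ('v \<Rightarrow> 'a::cstar_algebra) \<Rightarrow> ('e \<Rightarrow> 'a) \<Rightarrow> bool" where
  "ck_family \<equiv> ck_relations (=)"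

definition free_P :: "'v \<Rightarrow> ('v + 'e) free_star_algebra" where
  "free_P v = free_gen (Inl v)"

definition free_S :: "'e \<Rightarrow> ('v + 'e) free_star_algebra" where
  "free_S e = free_gen (Inr e)"

text \<open>
  \<open>graph_cstar_algebra E P S\<close>: the whole type \<^typ>\<open>'a\<close> is the C*-algebra of \<open>E\<close>, with canonical
  generators \<open>P\<close> and \<open>S\<close>. As usual for C*-algebras given by generators and relations, the universal
  algebra is the completion of the free *-algebra in the largest C*-seminorm killing the
  relations. Completing the free *-algebra in a C*-seminorm killing the relations yields a
  C*-algebra generated by a Cuntz-Krieger family, and every such C*-algebra arises in this way; so
  quantifying over these seminorms amounts to quantifying over all Cuntz-Krieger families in all
  C*-algebras. The mapping property is the lemma \<open>graph_cstar_algebra_universal\<close> below.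
\<close>

definition graph_cstar_algebra ::
  "('v, 'e) pre_digraph \<Rightarrow> ('v \<Rightarrow> 'a::cstar_algebra) \<Rightarrow> ('e \<Rightarrow> 'a) \<Rightarrow> bool" where
  "graph_cstar_algebra E P S \<longleftrightarrow>
     ck_family E P S \<and>
     closure (star_subalgebra (P ` verts E \<union> S ` arcs E)) = UNIV \<and>
     (\<forall>p :: ('v + 'e) free_star_algebra \<Rightarrow> real.
        cstar_seminorm p \<and> ck_relations (\<lambda>x y. p (x - y) = 0) E free_P free_S \<longrightarrow>
        (\<forall>x \<in> star_subalgebra (free_P ` verts E \<union> free_S ` arcs E).
           p x \<le> norm (free_eval (case_sum P S) x)))"

subsection \<open>Universal property\<close>

lemma star_homD:
  assumes "star_hom h"
  shows "h (x + y) = h x + h y" "h (c *\<^sub>C x) = c *\<^sub>C h x" "h (x * y) = h x * h y"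
    "h (star x) = star (h x)" "h 0 = 0" "h (- x) = - h x" "h (x - y) = h x - h y"
proof -
  have a: "h (x + y) = h x + h y" and c: "h (c *\<^sub>C x) = c *\<^sub>C h x" for x y c
    using assms by (auto simp: star_hom_def)
  show "h (x + y) = h x + h y" "h (c *\<^sub>C x) = c *\<^sub>C h x"
    by (fact a c)+
  show "h (x * y) = h x * h y" "h (star x) = star (h x)"
    using assms by (auto simp: star_hom_def)
  show "h 0 = 0"
    using a[of 0 0] by simp
  have m: "h (- x) = - h x" for x
    using c[of "-1" x] by (simp add: scaleC_minus_one)
  show "h (- x) = - h x" by (fact m)
  show "h (x - y) = h x - h y"
    using a[of x "- y"] m[of y] by simp
qed

lemma star_hom_sum:
  assumes "star_hom h"
  shows "h (\<Sum>i\<in>I. f i) = (\<Sum>i\<in>I. h (f i))"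
  by (induction I rule: infinite_finite_induct) (simp_all add: star_homD[OF assms])

lemma norm_star: "norm (star x) = norm (x :: 'a::cstar_algebra)"
proof -
  have le: "norm y \<le> norm (star y)" for y :: 'a
  proof (cases "y = 0")
    case False
    have "norm y * norm y \<le> norm (star y) * norm y"
      using norm_mult_ineq[of "star y" y] by (simp add: norm_star_mult power2_eq_square)
    then show ?thesis using False by simp
  qed simp
  show ?thesis using le[of x] le[of "star x"] by (simp add: star_algebra_class.star_star)
qed

lemma bounded_linear_star: "bounded_linear (star :: 'a::cstar_algebra \<Rightarrow> 'a)"
  by (rule bounded_linear_intro[where K = 1])
    (simp_all add: star_algebra_class.star_add star_algebra_class.star_scaleC scaleR_scaleC norm_star)

lemma bounded_linear_scaleC: "bounded_linear (scaleC c :: 'a::cstar_algebra \<Rightarrow> 'a)"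
  by (rule bounded_linear_intro[where K = "cmod c"])
    (simp_all add: star_algebra_class.scaleC_add_right scaleR_scaleC
      star_algebra_class.scaleC_scaleC norm_scaleC mult.commute)

lemma star_hom_image_subalgebra:
  assumes "star_hom h"
  shows "h ` star_subalgebra X = star_subalgebra (h ` X)"
proof
  have "h x \<in> star_subalgebra (h ` X)" if "x \<in> star_subalgebra X" for x
    using that by induction (auto simp: star_homD[OF assms] intro: star_subalgebra.intros)
  then show "h ` star_subalgebra X \<subseteq> star_subalgebra (h ` X)" by blast
  have "y \<in> h ` star_subalgebra X" if "y \<in> star_subalgebra (h ` X)" for y
    using that
  proof induction
    case (incl x) then show ?case by (auto intro: star_subalgebra.incl)
  next
    case zero show ?case
      using star_homD(5)[OF assms] star_subalgebra.zero[of X] by (metis image_eqI)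
  next
    case (add x y) then show ?case
      by (auto simp: star_homD(1)[OF assms, symmetric] intro!: imageI star_subalgebra.add)
  next
    case (scale x c) then show ?case
      by (auto simp: star_homD(2)[OF assms, symmetric] intro!: imageI star_subalgebra.scale)
  next
    case (mult x y) then show ?case
      by (auto simp: star_homD(3)[OF assms, symmetric] intro!: imageI star_subalgebra.mult)
  next
    case (star x) then show ?case
      by (auto simp: star_homD(4)[OF assms, symmetric] intro!: imageI star_subalgebra.star)
  qed
  then show "star_subalgebra (h ` X) \<subseteq> h ` star_subalgebra X" by blast
qed

lemma cstar_seminorm_norm_comp:
  fixes h :: "'b::star_algebra \<Rightarrow> 'a::cstar_algebra"
  assumes "star_hom h"
  shows "cstar_seminorm (\<lambda>x. norm (h x))"
  unfolding cstar_seminorm_def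
  by (simp add: star_homD[OF assms] norm_triangle_ineq norm_scaleC norm_mult_ineq norm_star_mult)

lemma ck_relations_norm_comp:
  fixes h :: "'b::star_algebra \<Rightarrow> 'a::cstar_algebra"
  assumes "star_hom h" "ck_family E (\<lambda>v. h (P v)) (\<lambda>e. h (S e))"
  shows "ck_relations (\<lambda>x y. norm (h (x - y)) = 0) E P S"
  using assms(2) unfolding ck_relations_def
  by (simp add: star_homD[OF assms(1)] star_hom_sum[OF assms(1)])

theorem graph_cstar_algebra_universal:
  fixes E :: "('v, 'e) pre_digraph" and P :: "'v \<Rightarrow> 'a::cstar_algebra" and Q :: "'v \<Rightarrow> 'b::cstar_algebra"
  assumes univ: "graph_cstar_algebra E P S" and ck: "ck_family E Q T"
  shows "\<exists>!h. star_hom h \<and> continuous_on UNIV h \<and>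
           (\<forall>v\<in>verts E. h (P v) = Q v) \<and> (\<forall>e\<in>arcs E. h (S e) = T e)"
proof -
  let ?F = "star_subalgebra (free_P ` verts E \<union> free_S ` arcs E) :: ('v + 'e) free_star_algebra set"
  let ?A = "star_subalgebra (P ` verts E \<union> S ` arcs E)"
  define i where "i = free_eval (case_sum P S)"
  define j where "j = free_eval (case_sum Q T)"
  have i: "star_hom i" and j: "star_hom j"
    unfolding i_def j_def by (rule star_hom_free_eval)+
  have iP: "i (free_P v) = P v" and jP: "j (free_P v) = Q v" for v
    by (simp_all add: i_def j_def free_P_def free_eval_gen)
  have iS: "i (free_S e) = S e" and jS: "j (free_S e) = T e" for e
    by (simp_all add: i_def j_def free_S_def free_eval_gen)
  have iF: "i ` ?F = ?A"
    by (simp add: star_hom_image_subalgebra[OF i] image_Un image_image iP iS)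
  have dense: "closure ?A = UNIV"
    using univ by (simp add: graph_cstar_algebra_def)
  have bound: "norm (j x) \<le> norm (i x)" if "x \<in> ?F" for x
  proof -
    have "cstar_seminorm (\<lambda>x. norm (j x))"
      by (rule cstar_seminorm_norm_comp[OF j])
    moreover have "ck_relations (\<lambda>x y. norm (j (x - y)) = 0) E free_P free_S"
      by (rule ck_relations_norm_comp[OF j]) (simp add: jP jS ck)
    ultimately show ?thesis
      using univ that unfolding graph_cstar_algebra_def i_def by blast
  qed
  have F_diff: "x - y \<in> ?F" if "x \<in> ?F" "y \<in> ?F" for x y
    using star_subalgebra.add[OF that(1) star_subalgebra.scale[OF that(2), of "-1"]]
    by (simp add: scaleC_minus_one)
  define k where "k a = j (SOME x. x \<in> ?F \<and> i x = a)" for a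
  have k: "k (i x) = j x" if "x \<in> ?F" for x
  proof -
    define y where "y = (SOME y. y \<in> ?F \<and> i y = i x)"
    have y: "y \<in> ?F \<and> i y = i x"
      unfolding y_def by (rule someI[of _ x]) (simp add: that)
    then have "norm (j (y - x)) \<le> 0"
      using bound[OF F_diff[of y x]] that by (simp add: star_homD[OF i])
    then show ?thesis by (simp add: k_def y_def[symmetric] star_homD[OF j])
  qed
  have "1-lipschitz_on ?A k"
  proof (rule lipschitz_onI)
    fix a b assume "a \<in> ?A" "b \<in> ?A"
    then obtain x y where "x \<in> ?F" "a = i x" "y \<in> ?F" "b = i y"
      unfolding iF[symmetric] by blast
    then show "dist (k a) (k b) \<le> 1 * dist a b"
      using bound[OF F_diff[of x y]] by (simp add: k dist_norm star_homD[OF i] star_homD[OF j])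
  qed simp
  then obtain h where "uniformly_continuous_on (closure ?A) h" and hk: "\<And>a. a \<in> ?A \<Longrightarrow> k a = h a"
    using uniformly_continuous_on_extension_on_closure[of ?A k]
    by (metis lipschitz_on_uniformly_continuous)
  then have cont: "continuous_on UNIV h"
    using dense uniformly_continuous_imp_continuous by auto
  have hi: "h (i x) = j x" if "x \<in> ?F" for x
  proof -
    have "i x \<in> ?A" using iF that by blast
    then show ?thesis using k[OF that] hk[of "i x"] by simp
  qed
  have approx: "\<exists>f. (\<forall>n. f n \<in> ?F) \<and> (\<lambda>n. i (f n)) \<longlonglongrightarrow> a" for a
  proof -
    have "a \<in> closure ?A" using dense by simp
    then obtain g where g: "\<forall>n. g n \<in> ?A" "g \<longlonglongrightarrow> a"
      unfolding closure_sequential by blast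
    then have "\<forall>n. \<exists>x. x \<in> ?F \<and> g n = i x"
      unfolding iF[symmetric] by blast
    then obtain f where "\<forall>n. f n \<in> ?F \<and> g n = i (f n)" by metis
    then show ?thesis using g by (metis (no_types, lifting) ext)
  qed
  have lim: "(\<lambda>n. h (f n)) \<longlonglongrightarrow> h a" if "f \<longlonglongrightarrow> a" for f a
    using continuous_on_tendsto_compose[OF cont that] by simp
  have hom: "star_hom h"
    unfolding star_hom_def
  proof (intro conjI allI)
    fix a b :: 'a and c :: complex
    obtain f where f: "\<And>n. f n \<in> ?F" "(\<lambda>n. i (f n)) \<longlonglongrightarrow> a" using approx by metis
    obtain g where g: "\<And>n. g n \<in> ?F" "(\<lambda>n. i (g n)) \<longlonglongrightarrow> b" using approx by metis
    have hf: "(\<lambda>n. j (f n)) \<longlonglongrightarrow> h a" using lim[OF f(2)] by (simp add: hi f(1))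
    have hg: "(\<lambda>n. j (g n)) \<longlonglongrightarrow> h b" using lim[OF g(2)] by (simp add: hi g(1))
    have "(\<lambda>n. j (f n + g n)) \<longlonglongrightarrow> h (a + b)"
      using lim[OF tendsto_add[OF f(2) g(2)]]
      by (simp only: star_homD(1)[OF i, symmetric] hi star_subalgebra.add f(1) g(1))
    then show "h (a + b) = h a + h b"
      using tendsto_add[OF hf hg] unfolding star_homD(1)[OF j] by (rule LIMSEQ_unique)
    have "(\<lambda>n. j (f n * g n)) \<longlonglongrightarrow> h (a * b)"
      using lim[OF tendsto_mult[OF f(2) g(2)]]
      by (simp only: star_homD(3)[OF i, symmetric] hi star_subalgebra.mult f(1) g(1))
    then show "h (a * b) = h a * h b"
      using tendsto_mult[OF hf hg] unfolding star_homD(3)[OF j] by (rule LIMSEQ_unique)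
    have "(\<lambda>n. j (c *\<^sub>C f n)) \<longlonglongrightarrow> h (c *\<^sub>C a)"
      using lim[OF bounded_linear.tendsto[OF bounded_linear_scaleC f(2)]]
      by (simp only: star_homD(2)[OF i, symmetric] hi star_subalgebra.scale f(1))
    then show "h (c *\<^sub>C a) = c *\<^sub>C h a"
      using bounded_linear.tendsto[OF bounded_linear_scaleC hf]
      unfolding star_homD(2)[OF j] by (rule LIMSEQ_unique)
    have "(\<lambda>n. j (star (f n))) \<longlonglongrightarrow> h (star a)"
      using lim[OF bounded_linear.tendsto[OF bounded_linear_star f(2)]]
      by (simp only: star_homD(4)[OF i, symmetric] hi star_subalgebra.star f(1))
    then show "h (star a) = star (h a)"
      using bounded_linear.tendsto[OF bounded_linear_star hf]
      unfolding star_homD(4)[OF j] by (rule LIMSEQ_unique)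
  qed
  have gens: "(\<forall>v\<in>verts E. h (P v) = Q v) \<and> (\<forall>e\<in>arcs E. h (S e) = T e)"
  proof (intro conjI ballI)
    fix v assume "v \<in> verts E"
    then have "free_P v \<in> ?F" by (auto intro: star_subalgebra.incl)
    then show "h (P v) = Q v" using hi[of "free_P v"] by (simp add: iP jP)
  next
    fix e assume "e \<in> arcs E"
    then have "free_S e \<in> ?F" by (auto intro: star_subalgebra.incl)
    then show "h (S e) = T e" using hi[of "free_S e"] by (simp add: iS jS)
  qed
  show ?thesis
  proof (rule ex1I[of _ h])
    show "star_hom h \<and> continuous_on UNIV h \<and>
           (\<forall>v\<in>verts E. h (P v) = Q v) \<and> (\<forall>e\<in>arcs E. h (S e) = T e)"
      using hom cont gens by blast
  next
    fix g assume g: "star_hom g \<and> continuous_on UNIV g \<and>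
           (\<forall>v\<in>verts E. g (P v) = Q v) \<and> (\<forall>e\<in>arcs E. g (S e) = T e)"
    then have g_hom: "star_hom g" by blast
    have "g a = h a" if "a \<in> ?A" for a
      using that
      by induction (use g gens in \<open>auto simp: star_homD[OF g_hom] star_homD[OF hom]\<close>)
    moreover have "closed {a. g a = h a}"
      using g cont by (intro closed_Collect_eq) auto
    ultimately have "closure ?A \<subseteq> {a. g a = h a}"
      by (intro closure_minimal) auto
    then show "g = h" using dense by auto
  qed
qed


section \<open>Subspaces, endomorphisms and the shift\<close>

text \<open>
  A path is a pair of its first vertex and its list of arcs, so that the paths of length \<open>0\<close> are the
  vertices.
\<close>

definition paths :: "('v, 'e) pre_digraph \<Rightarrow> nat \<Rightarrow> ('v \<times> 'e list) set" where
  "paths E k = {(v, p). length p = k \<and> (\<exists>w. pre_digraph.awalk E v p w)}"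

fun path_elem :: "('v \<Rightarrow> 'a::star_algebra) \<Rightarrow> ('e \<Rightarrow> 'a) \<Rightarrow> 'v \<times> 'e list \<Rightarrow> 'a" where
  "path_elem P S (v, []) = P v"
| "path_elem P S (v, [e]) = S e"
| "path_elem P S (v, e # f # p) = S e * path_elem P S (v, f # p)"

definition core_F ::
  "('v, 'e) pre_digraph \<Rightarrow> ('v \<Rightarrow> 'a::star_algebra) \<Rightarrow> ('e \<Rightarrow> 'a) \<Rightarrow> nat \<Rightarrow> 'a set" where
  "core_F E P S k =
     cspan {path_elem P S \<mu> * star (path_elem P S \<nu>) | \<mu> \<nu>. \<mu> \<in> paths E k \<and> \<nu> \<in> paths E k}"

definition diag_D0 :: "('v, 'e) pre_digraph \<Rightarrow> ('v \<Rightarrow> 'a::star_algebra) \<Rightarrow> 'a set" where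
  "diag_D0 E P = cspan (P ` verts E)"

definition graph_unitaries :: "('v, 'e) pre_digraph \<Rightarrow> ('v \<Rightarrow> 'a::star_algebra) \<Rightarrow> 'a set" where
  "graph_unitaries E P = {u. unitary u \<and> (\<forall>v\<in>verts E. u * P v = P v * u)}"

text \<open>
  Continuity is automatic for *-homomorphisms between C*-algebras; it is listed only to make the
  uniqueness of \<open>\<lambda>\<^sub>u\<close> immediate from the density of the *-algebra generated by \<open>P\<close> and \<open>S\<close>.
\<close>

definition lambda_endo ::
  "('v, 'e) pre_digraph \<Rightarrow> ('v \<Rightarrow> 'a::cstar_algebra) \<Rightarrow> ('e \<Rightarrow> 'a) \<Rightarrow> 'a \<Rightarrow> ('a \<Rightarrow> 'a)" where
  "lambda_endo E P S u =
     (THE h. star_hom h \<and> continuous_on UNIV h \<and> (\<forall>e. is_identity e \<longrightarrow> is_identity (h e)) \<and>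
             (\<forall>v\<in>verts E. h (P v) = P v) \<and> (\<forall>e\<in>arcs E. h (S e) = u * S e))"

definition localized ::
  "('v, 'e) pre_digraph \<Rightarrow> ('v \<Rightarrow> 'a::cstar_algebra) \<Rightarrow> ('e \<Rightarrow> 'a) \<Rightarrow> ('a \<Rightarrow> 'a) \<Rightarrow> bool" where
  "localized E P S h \<longleftrightarrow>
     (\<exists>l. \<exists>w \<in> core_F E P S l \<inter> graph_unitaries E P. h = lambda_endo E P S w)"

definition shift :: "('v, 'e) pre_digraph \<Rightarrow> ('e \<Rightarrow> 'a::star_algebra) \<Rightarrow> 'a \<Rightarrow> 'a" where
  "shift E S x = (\<Sum>e\<in>arcs E. S e * x * star (S e))"

text \<open>
  For finitely many vertices, the sum of the \<open>P\<^sub>v\<close> is the unit of the graph C*-algebra; it serves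
  as the empty product \<open>u\<^sub>0\<close>.
\<close>

primrec cocycle ::
  "('v, 'e) pre_digraph \<Rightarrow> ('v \<Rightarrow> 'a::star_algebra) \<Rightarrow> ('e \<Rightarrow> 'a) \<Rightarrow> 'a \<Rightarrow> nat \<Rightarrow> 'a" where
  "cocycle E P S u 0 = (\<Sum>v\<in>verts E. P v)"
| "cocycle E P S u (Suc m) = cocycle E P S u m * (shift E S ^^ m) u"

lemma star_zero: "star 0 = (0 :: 'a::star_algebra)"
  using star_algebra_class.star_add[of 0 0] by (simp del: star_algebra_class.star_add)

lemma star_sum: "star (\<Sum>i\<in>I. f i) = (\<Sum>i\<in>I. star (f i :: 'a::star_algebra))"
  by (induction I rule: infinite_finite_induct)
    (simp_all add: star_zero star_algebra_class.star_add)

lemma ck_identity: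
  fixes P :: "'v \<Rightarrow> 'a::cstar_algebra"
  assumes fin: "fin_digraph E" and univ: "graph_cstar_algebra E P S"
  shows "is_identity (\<Sum>v\<in>verts E. P v)"
proof -
  interpret fin_digraph E by (rule fin)
  let ?A = "star_subalgebra (P ` verts E \<union> S ` arcs E)"
  let ?p = "\<Sum>v\<in>verts E. P v"
  have ck: "ck_family E P S" and dense: "closure ?A = UNIV"
    using univ by (simp_all add: graph_cstar_algebra_def)
  have star_P: "star (P v) = P v" if "v \<in> verts E" for v
    using ck that by (simp add: ck_relations_def)
  have PP: "P v * P w = (if v = w then P v else 0)" if "v \<in> verts E" "w \<in> verts E" for v w
    using ck that by (auto simp: ck_relations_def)
  have Pl: "?p * P w = P w" if "w \<in> verts E" for w
    using that by (simp add: sum_distrib_right PP cong: sum.cong)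
  have Pr: "P w * ?p = P w" if "w \<in> verts E" for w
    using that by (simp add: sum_distrib_left PP cong: sum.cong)
  have star_p: "star ?p = ?p"
    by (simp add: star_sum star_P)
  have SS: "S e = S e * star (S e) * S e" if "e \<in> arcs E" for e
    using ck that by (simp add: ck_relations_def)
  have Sl: "?p * S e = S e" if "e \<in> arcs E" for e
  proof -
    have "P (tail E e) * (S e * star (S e)) = S e * star (S e)"
      using ck that by (simp add: ck_relations_def)
    then have "?p * (S e * star (S e)) = S e * star (S e)"
      using Pl[of "tail E e"] that by (metis mult.assoc tail_in_verts)
    then show ?thesis using SS[OF that] by (metis mult.assoc)
  qed
  have Sr: "S e * ?p = S e" if "e \<in> arcs E" for e
  proof -
    have "star (S e) * S e = P (head E e)"
      using ck that by (simp add: ck_relations_def)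
    then have "star (S e) * S e * ?p = star (S e) * S e"
      using Pr[of "head E e"] that by simp
    then show ?thesis using SS[OF that] by (metis mult.assoc)
  qed
  have A: "?p * a = a \<and> a * ?p = a" if "a \<in> ?A" for a
    using that
  proof induction
    case (incl x) then show ?case using Pl Pr Sl Sr by auto
  next
    case (add x y) then show ?case by (simp add: Rings.ring_distribs)
  next
    case (mult x y) then show ?case by (metis mult.assoc)
  next
    case (star x) then show ?case by (metis star_p star_algebra_class.star_mult)
  qed (simp_all add: star_algebra_class.mult_scaleC_left star_algebra_class.mult_scaleC_right)
  have "closed {a. ?p * a = a \<and> a * ?p = a}"
    by (intro closed_Collect_conj closed_Collect_eq continuous_intros)
  then have "closure ?A \<subseteq> {a. ?p * a = a \<and> a * ?p = a}"
    by (intro closure_minimal) (use A in auto)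
  then show ?thesis using dense by (auto simp: is_identity_def)
qed

lemma lambda_endo_ex1:
  fixes P :: "'v \<Rightarrow> 'a::cstar_algebra"
  assumes fin: "fin_digraph E" and univ: "graph_cstar_algebra E P S"
    and u: "u \<in> graph_unitaries E P"
  shows "\<exists>!h. star_hom h \<and> continuous_on UNIV h \<and> (\<forall>e. is_identity e \<longrightarrow> is_identity (h e)) \<and>
             (\<forall>v\<in>verts E. h (P v) = P v) \<and> (\<forall>e\<in>arcs E. h (S e) = u * S e)"
proof -
  interpret fin_digraph E by (rule fin)
  have ck: "ck_family E P S"
    using univ by (simp add: graph_cstar_algebra_def)
  have uu: "star u * u * x = x" "u * star u * x = x" "star u * (u * x) = x" "u * (star u * x) = x" for x
    using u by (simp_all add: graph_unitaries_def unitary_def is_identity_def mult.assoc)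
  have uP: "u * P v = P v * u" if "v \<in> verts E" for v
    using u that by (simp add: graph_unitaries_def)
  have uPu': "u * (P v * star u) = P v" if "v \<in> verts E" for v
  proof -
    have "u * (P v * star u) = P v * (u * star u)"
      using uP[OF that] by (simp add: mult.assoc[symmetric])
    then show ?thesis
      using u by (simp add: graph_unitaries_def unitary_def is_identity_def)
  qed
  have "ck_family E P (\<lambda>e. u * S e)"
    unfolding ck_relations_def
  proof (intro conjI ballI impI)
    fix e assume e: "e \<in> arcs E"
    then have 1: "S e * (star (S e) * S e) = S e" and 2: "star (S e) * S e = P (head E e)"
      and 3: "P (tail E e) * (S e * star (S e)) = S e * star (S e)"
      using ck by (auto simp: ck_relations_def mult.assoc)
    show "u * S e * star (u * S e) * (u * S e) = u * S e"
      using 1 by (simp add: star_algebra_class.star_mult mult.assoc uu)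
    show "star (u * S e) * (u * S e) = P (head E e)"
      using 2 by (simp add: star_algebra_class.star_mult mult.assoc uu)
    have "P (tail E e) * (u * S e * star (u * S e)) = u * (P (tail E e) * (S e * star (S e))) * star u"
      using uP[OF tail_in_verts[OF e]] by (simp add: star_algebra_class.star_mult mult.assoc[symmetric])
    then show "P (tail E e) * (u * S e * star (u * S e)) = u * S e * star (u * S e)"
      by (simp add: 3 star_algebra_class.star_mult mult.assoc)
  next
    fix e f assume "e \<in> arcs E" "f \<in> arcs E" "e \<noteq> f"
    then have "star (S e) * S f = 0" using ck by (auto simp: ck_relations_def)
    then show "star (u * S e) * (u * S f) = 0"
      by (simp add: star_algebra_class.star_mult mult.assoc uu)
  next
    fix v assume v: "v \<in> verts E" "finite (out_arcs E v) \<and> out_arcs E v \<noteq> {}"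
    then have "P v = (\<Sum>e\<in>out_arcs E v. S e * star (S e))"
      using ck by (auto simp: ck_relations_def)
    then have "u * (P v * star u) = (\<Sum>e\<in>out_arcs E v. u * S e * star (u * S e))"
      by (simp add: sum_distrib_left sum_distrib_right star_algebra_class.star_mult mult.assoc)
    then show "P v = (\<Sum>e\<in>out_arcs E v. u * S e * star (u * S e))"
      by (simp add: uPu' v)
  qed (use ck in \<open>auto simp: ck_relations_def\<close>)
  from graph_cstar_algebra_universal[OF univ this]
  obtain h where h: "star_hom h \<and> continuous_on UNIV h \<and>
      (\<forall>v\<in>verts E. h (P v) = P v) \<and> (\<forall>e\<in>arcs E. h (S e) = u * S e)"
    and unique: "\<And>g. star_hom g \<and> continuous_on UNIV g \<and>
      (\<forall>v\<in>verts E. g (P v) = P v) \<and> (\<forall>e\<in>arcs E. g (S e) = u * S e) \<Longrightarrow> g = h"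
    by (elim ex1E) blast
  have "is_identity (h e)" if "is_identity e" for e
  proof -
    have id: "is_identity (\<Sum>v\<in>verts E. P v)" by (rule ck_identity[OF fin univ])
    then have "e = (\<Sum>v\<in>verts E. P v)" using that by (metis is_identity_def)
    then have "h e = (\<Sum>v\<in>verts E. P v)" using h by (simp add: star_hom_sum)
    then show ?thesis using id by simp
  qed
  with h unique show ?thesis by (intro ex1I[of _ h]) blast+
qed


section \<open>The ring \<open>A\<^sub>u\<close>\<close>

text \<open>
  Subrings need not be unital, so \<open>generate_ring\<close> of HOL-Algebra is not applicable. The \<open>l\<close>-th power of a
  subring is the additive subgroup generated by the \<open>l\<close>-fold products.
\<close>

inductive_set generate_rng :: "('a, 'b) ring_scheme \<Rightarrow> 'a set \<Rightarrow> 'a set" for R and H where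
  zero: "\<zero>\<^bsub>R\<^esub> \<in> generate_rng R H"
| incl: "h \<in> H \<Longrightarrow> h \<in> generate_rng R H"
| a_inv: "h \<in> generate_rng R H \<Longrightarrow> \<ominus>\<^bsub>R\<^esub> h \<in> generate_rng R H"
| add: "h1 \<in> generate_rng R H \<Longrightarrow> h2 \<in> generate_rng R H \<Longrightarrow> h1 \<oplus>\<^bsub>R\<^esub> h2 \<in> generate_rng R H"
| mult: "h1 \<in> generate_rng R H \<Longrightarrow> h2 \<in> generate_rng R H \<Longrightarrow> h1 \<otimes>\<^bsub>R\<^esub> h2 \<in> generate_rng R H"

fun rng_power :: "('a, 'b) ring_scheme \<Rightarrow> 'a set \<Rightarrow> nat \<Rightarrow> 'a set" where
  "rng_power R A 0 = carrier R"
| "rng_power R A (Suc 0) = A"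
| "rng_power R A (Suc (Suc l)) = ideal_prod R (rng_power R A (Suc l)) A"

definition nilpotent_rng :: "('a, 'b) ring_scheme \<Rightarrow> 'a set \<Rightarrow> bool" where
  "nilpotent_rng R A \<longleftrightarrow> (\<exists>l\<ge>1. rng_power R A l = {\<zero>\<^bsub>R\<^esub>})"

text \<open>
  The elements of the quotient vector space \<open>W / D\<close> are the cosets \<^term>\<open>x +o D\<close>. Cosets are added
  as sets, the zero coset is \<open>D\<close>, and \<open>coset_scale D c\<close> maps \<^term>\<open>x +o D\<close> to
  \<^term>\<open>(c *\<^sub>C x) +o D\<close>. Maps on \<open>W / D\<close> are extensional functions.
\<close>

definition quotient_space :: "'a::star_algebra set \<Rightarrow> 'a set \<Rightarrow> 'a set set" where
  "quotient_space W D = (\<lambda>x. x +o D) ` W"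

definition coset_scale :: "'a::star_algebra set \<Rightarrow> complex \<Rightarrow> 'a set \<Rightarrow> 'a set" where
  "coset_scale D c X = (\<Union>x\<in>X. (c *\<^sub>C x) +o D)"

definition quotient_linear_maps :: "'a::star_algebra set \<Rightarrow> 'a set \<Rightarrow> ('a set \<Rightarrow> 'a set) set" where
  "quotient_linear_maps W D =
     {g \<in> quotient_space W D \<rightarrow>\<^sub>E quotient_space W D.
        (\<forall>X\<in>quotient_space W D. \<forall>Y\<in>quotient_space W D. g (X + Y) = g X + g Y) \<and>
        (\<forall>c. \<forall>X\<in>quotient_space W D. g (coset_scale D c X) = coset_scale D c (g X))}"

definition quotient_linear_ring ::
  "'a::star_algebra set \<Rightarrow> 'a set \<Rightarrow> ('a set \<Rightarrow> 'a set) Ring.ring" where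
  "quotient_linear_ring W D =
     \<lparr> carrier = quotient_linear_maps W D,
       mult = compose (quotient_space W D),
       one = (\<lambda>X\<in>quotient_space W D. X),
       zero = (\<lambda>X\<in>quotient_space W D. D),
       add = (\<lambda>g h. \<lambda>X\<in>quotient_space W D. g X + h X) \<rparr>"

definition quotient_map :: "'a::star_algebra set \<Rightarrow> 'a set \<Rightarrow> ('a \<Rightarrow> 'a) \<Rightarrow> ('a set \<Rightarrow> 'a set)" where
  "quotient_map W D a = (\<lambda>X\<in>quotient_space W D. \<Union>x\<in>X. a x +o D)"

definition a_map :: "('e \<Rightarrow> 'a::star_algebra) \<Rightarrow> 'a \<Rightarrow> 'e \<Rightarrow> 'e \<Rightarrow> 'a \<Rightarrow> 'a" where
  "a_map S u e f x = star (S e) * star u * x * u * S f"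

definition L_ring ::
  "('v, 'e) pre_digraph \<Rightarrow> ('v \<Rightarrow> 'a::star_algebra) \<Rightarrow> ('e \<Rightarrow> 'a) \<Rightarrow> nat \<Rightarrow> ('a set \<Rightarrow> 'a set) Ring.ring"
where
  "L_ring E P S k = quotient_linear_ring (core_F E P S (k - 1)) (diag_D0 E P)"

definition A_ring ::
  "('v, 'e) pre_digraph \<Rightarrow> ('v \<Rightarrow> 'a::star_algebra) \<Rightarrow> ('e \<Rightarrow> 'a) \<Rightarrow> nat \<Rightarrow> 'a \<Rightarrow> ('a set \<Rightarrow> 'a set) set"
where
  "A_ring E P S k u = generate_rng (L_ring E P S k)
     {quotient_map (core_F E P S (k - 1)) (diag_D0 E P) (a_map S u e f) | e f.
        e \<in> arcs E \<and> f \<in> arcs E}"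


section \<open>The subspace \<open>\<Xi>\<^sub>u\<close>\<close>

primrec Xi_seq ::
  "('v, 'e) pre_digraph \<Rightarrow> ('v \<Rightarrow> 'a::cstar_algebra) \<Rightarrow> ('e \<Rightarrow> 'a) \<Rightarrow> nat \<Rightarrow> 'a \<Rightarrow> nat \<Rightarrow> 'a set"
where
  "Xi_seq E P S k u 0 = core_F E P S (k - 1)"
| "Xi_seq E P S k u (Suc r) =
     cspan {star y * x * z | y x z.
       y \<in> lambda_endo E P S u ` cspan (S ` arcs E) \<and> x \<in> Xi_seq E P S k u r \<and>
       z \<in> lambda_endo E P S u ` cspan (S ` arcs E)}"

definition Xi ::
  "('v, 'e) pre_digraph \<Rightarrow> ('v \<Rightarrow> 'a::cstar_algebra) \<Rightarrow> ('e \<Rightarrow> 'a) \<Rightarrow> nat \<Rightarrow> 'a \<Rightarrow> 'a set" where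
  "Xi E P S k u = (\<Inter>r. Xi_seq E P S k u r)"

end

theory Submission
  imports Defs
begin

text \<open>
  Write \<open>F k\<close> for the core spanned by the \<open>S\<^sub>\<mu> S\<^sub>\<nu>\<^sup>*\<close> with paths of length \<open>k\<close>, \<open>D\<close> for the span of
  the vertex projections, and \<open>k = n + 1\<close> for the level with \<open>u \<in> F k\<close>. All four conditions are
  shown to be equivalent to a single one:

    (Y) \<open>u\<^sup>* \<in> \<lambda>\<^sub>u(F l)\<close> for some \<open>l\<close>.

  Two facts drive the proof. On \<open>F m\<close> the endomorphism \<open>\<lambda>\<^sub>u\<close> is \<open>Ad(u\<^sub>m)\<close>, so it is injective on the
  union of the \<open>F m\<close>. And \<open>\<lambda>\<^sub>u \<lambda>\<^sub>w\<close> is determined by \<open>\<lambda>\<^sub>u \<lambda>\<^sub>w (S\<^sub>e) = \<lambda>\<^sub>u(w) u S\<^sub>e\<close>, so it is the identity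
  exactly when \<open>\<lambda>\<^sub>u(w) = u\<^sup>*\<close>.

  Invertibility (\<open>invertible_iff\<close>): a localized inverse \<open>\<lambda>\<^sub>w\<close> satisfies \<open>\<lambda>\<^sub>u(w) = u\<^sup>*\<close>, which is (Y).
  Conversely, let \<open>\<lambda>\<^sub>u(w) = u\<^sup>*\<close> with \<open>w \<in> F l\<close>. Then \<open>w = Ad(u\<^sub>l\<^sup>*)(u\<^sup>*)\<close> is a unitary commuting with the
  vertex projections, \<open>\<lambda>\<^sub>u \<lambda>\<^sub>w = id\<close>, and \<open>\<lambda>\<^sub>u\<close> maps \<open>\<lambda>\<^sub>w(u) w\<close> to \<open>u u\<^sup>* = 1\<close>. That element lies in some
  \<open>F m\<close>, so it is \<open>1\<close> by injectivity, and \<open>\<lambda>\<^sub>w \<lambda>\<^sub>u = id\<close> too.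

  Stabilization (\<open>stabilizes_iff\<close>): for \<open>w \<in> F l\<close> and \<open>m \<ge> l\<close>, the equation \<open>\<lambda>\<^sub>u(w) = u\<^sup>*\<close> says
  \<open>w = Ad(u\<^sub>m\<^sup>*)(u\<^sup>*)\<close>.

  The spaces \<open>\<Xi>\<^sub>r\<close> (\<open>Xi_vanishes_iff\<close>): \<open>\<Xi>\<^sub>r\<close> is spanned by the \<open>r\<close>-fold composites of the maps \<open>a\<^sub>e\<^sub>f\<close>
  applied to \<open>F n\<close>. From \<open>a\<^sub>e\<^sub>f(\<lambda>\<^sub>u(y)) = \<lambda>\<^sub>u(S\<^sub>e\<^sup>* y S\<^sub>f)\<close> it follows that each \<open>a\<^sub>e\<^sub>f\<close> carries
  \<open>\<lambda>\<^sub>u(F (l + 1))\<close> to \<open>\<lambda>\<^sub>u(F l)\<close>; and since \<open>x\<close> is the sum of the \<open>(u S\<^sub>e) a\<^sub>e\<^sub>f(x) (u S\<^sub>f)\<^sup>*\<close>, an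
  element all of whose images \<open>a\<^sub>e\<^sub>f(x)\<close> are in \<open>\<lambda>\<^sub>u(F l)\<close> is itself in \<open>\<lambda>\<^sub>u(F (l + 1))\<close>. As
  \<open>\<lambda>\<^sub>u(F 0) = D\<close>, some \<open>\<Xi>\<^sub>l\<close> is contained in \<open>D\<close> exactly when \<open>F n \<subseteq> \<lambda>\<^sub>u(F l)\<close> for some \<open>l\<close>, and this
  amounts to (Y).

  The last two conditions are both about \<open>\<Xi>\<^sub>l \<subseteq> D\<close> for some \<open>l\<close>. For the ring \<open>A\<^sub>u\<close> this is linear algebra
  on a quotient space (\<open>nilpotent_iff\<close>), and for the intersection of all \<open>\<Xi>\<^sub>r\<close> it holds because a
  decreasing sequence of finite-dimensional spaces becomes constant
  (\<open>decreasing_csubspaces_stabilize\<close>).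
\<close>

section \<open>Complex subspaces\<close>

abbreviation csubspace :: "'a::star_algebra set \<Rightarrow> bool" where
  "csubspace \<equiv> complex_vector.subspace"

text \<open>
  The scalars are twisted by \<open>\<sigma>\<close> because the adjoint is conjugate-linear.
\<close>

lemma cspan_semilinear_map_into:
  assumes "x \<in> cspan B" "csubspace T" "\<And>x. x \<in> B \<Longrightarrow> f x \<in> T"
    and "\<And>x y. f (x + y) = f x + f y" "\<And>c x. f (c *\<^sub>C x) = \<sigma> c *\<^sub>C f x"
  shows "f x \<in> T"
  using assms(1)
proof (induction rule: complex_vector.span_induct_alt)
  case base
  have "f (0 + 0) = f 0 + f 0" by (rule assms(4))
  then have "f 0 = 0" by simp
  then show ?case using assms(2) by (simp add: complex_vector.subspace_0)
next
  case (step c x y)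
  then show ?case
    using assms(2-5) by (simp add: complex_vector.subspace_add complex_vector.subspace_scale)
qed

lemmas cspan_map_into = cspan_semilinear_map_into[where \<sigma> = "\<lambda>c. c"]

lemma cspan_eq_on:
  assumes "x \<in> cspan B" "\<And>x. x \<in> B \<Longrightarrow> f x = g x"
    and "\<And>x y. f (x + y) = f x + f y" "\<And>c x. f (c *\<^sub>C x) = c *\<^sub>C f x"
    and "\<And>x y. g (x + y) = g x + g y" "\<And>c x. g (c *\<^sub>C x) = c *\<^sub>C g x"
  shows "f x = g x"
proof -
  have "f x - g x \<in> {0}"
    using assms(1)
    by (rule cspan_map_into[where f = "\<lambda>x. f x - g x"])
      (simp_all add: assms complex_vector.subspace_def complex_vector.scale_right_diff_distrib)
  then show ?thesis by simp
qed

lemma csubspace_image_star_hom: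
  assumes "star_hom h" "csubspace V"
  shows "csubspace (h ` V)"
  unfolding complex_vector.subspace_def
proof (intro conjI ballI allI)
  show "0 \<in> h ` V"
    using star_homD(5)[OF assms(1)] complex_vector.subspace_0[OF assms(2)] by (metis image_eqI)
  fix x c assume "x \<in> h ` V"
  then show "c *\<^sub>C x \<in> h ` V"
    using star_homD(2)[OF assms(1)] complex_vector.subspace_scale[OF assms(2)]
    by (smt (verit) image_iff)
next
  fix x y assume "x \<in> h ` V" "y \<in> h ` V"
  then show "x + y \<in> h ` V"
    using star_homD(1)[OF assms(1)] complex_vector.subspace_add[OF assms(2)]
    by (smt (verit) image_iff)
qed

text \<open>
  Take \<open>R\<close> with \<open>V R\<close> of least dimension: if \<open>V r\<close> were strictly smaller, adding a vector of \<open>V R\<close> to a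
  basis of \<open>V r\<close> would give an independent set in \<open>V R\<close> with more elements than a basis of \<open>V R\<close>.
\<close>

lemma decreasing_csubspaces_stabilize:
  assumes "finite B" "V 0 \<subseteq> cspan B"
    and sub: "\<And>r. csubspace (V r)" and dec: "\<And>r. V (Suc r) \<subseteq> V r"
  shows "\<exists>R. \<forall>r\<ge>R. V r = V R"
proof -
  have mono: "V s \<subseteq> V r" if "r \<le> s" for r s
    using lift_Suc_antimono_le[of V, OF dec that] .
  define d where "d r = complex_vector.dim (V r)" for r
  obtain R where R: "\<And>r. d R \<le> d r"
    using ex_has_least_nat[of "\<lambda>_. True" 0 d] by auto
  have "V r = V R" if "R \<le> r" for r
  proof (rule antisym)
    show "V r \<subseteq> V R" by (rule mono[OF that])
    obtain C where C: "C \<subseteq> V r" "complex_vector.independent C" "V r \<subseteq> cspan C" "card C = d r"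
      using complex_vector.basis_exists[of "V r"] unfolding d_def by metis
    obtain A where A: "A \<subseteq> V R" "complex_vector.independent A" "V R \<subseteq> cspan A" "card A = d R"
      using complex_vector.basis_exists[of "V R"] unfolding d_def by metis
    have "finite A"
      using complex_vector.independent_span_bound[OF assms(1) A(2)] A(1) mono[of 0 R] assms(2) by auto
    have "finite C"
      using complex_vector.independent_span_bound[OF assms(1) C(2)] C(1) mono[of 0 r] assms(2) by auto
    show "V R \<subseteq> V r"
    proof (rule ccontr)
      assume "\<not> V R \<subseteq> V r"
      then obtain x where x: "x \<in> V R" "x \<notin> V r" by blast
      have "cspan C \<subseteq> V r" by (rule complex_vector.span_minimal[OF C(1) sub])
      then have xC: "x \<notin> cspan C" using x by blast
      then have "x \<notin> C" using complex_vector.span_base by blast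
      have "complex_vector.independent (insert x C)"
        using C(2) xC by (simp add: complex_vector.independent_insert)
      moreover have "insert x C \<subseteq> cspan A"
        using A(3) C(1) x(1) mono[OF that] by auto
      ultimately have "card (insert x C) \<le> card A"
        using complex_vector.independent_span_bound[OF \<open>finite A\<close>] by blast
      then show False
        using \<open>finite C\<close> \<open>x \<notin> C\<close> A(4) C(4) R[of r] by simp
    qed
  qed
  then show ?thesis by blast
qed

section \<open>Nilpotent rings of maps on a quotient space\<close>

text \<open>
  A set \<open>M\<close> of linear maps on \<open>W\<close> leaving \<open>D\<close> invariant induces maps on \<open>W / D\<close>. The ring that these
  generate is nilpotent iff the composites of some fixed number of members of \<open>M\<close> all map \<open>W\<close> into \<open>D\<close>;
  the spans of the images of \<open>W\<close> under such composites are the iterated images below.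
\<close>

locale quotient_maps =
  fixes W D :: "'a::star_algebra set" and M :: "('a \<Rightarrow> 'a) set"
  assumes subspace_W: "csubspace W" and subspace_D: "csubspace D" and D_subset_W: "D \<subseteq> W"
    and additive: "\<And>a x y. a \<in> M \<Longrightarrow> a (x + y) = a x + a y"
    and homogeneous: "\<And>a c x. a \<in> M \<Longrightarrow> a (c *\<^sub>C x) = c *\<^sub>C a x"
    and maps_W: "\<And>a x. a \<in> M \<Longrightarrow> x \<in> W \<Longrightarrow> a x \<in> W"
    and maps_D: "\<And>a x. a \<in> M \<Longrightarrow> x \<in> D \<Longrightarrow> a x \<in> D"
begin

abbreviation Q :: "'a set set" where "Q \<equiv> quotient_space W D"
abbreviation R :: "('a set \<Rightarrow> 'a set) Ring.ring" where "R \<equiv> quotient_linear_ring W D"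
abbreviation A :: "('a set \<Rightarrow> 'a set) set" where "A \<equiv> generate_rng R (quotient_map W D ` M)"

primrec iterated_images :: "nat \<Rightarrow> 'a set" where
  "iterated_images 0 = W"
| "iterated_images (Suc r) = cspan {a x | a x. a \<in> M \<and> x \<in> iterated_images r}"

lemmas D_mem = complex_vector.subspace_0[OF subspace_D] complex_vector.subspace_add[OF subspace_D]
  complex_vector.subspace_scale[OF subspace_D] complex_vector.subspace_diff[OF subspace_D]
  complex_vector.subspace_neg[OF subspace_D]

lemma mem_coset: "z \<in> x +o D \<longleftrightarrow> z - x \<in> D"
  unfolding elt_set_plus_def by (auto intro: bexI[of _ "z - x"])

lemma coset_eq_iff: "x +o D = y +o D \<longleftrightarrow> x - y \<in> D"
proof
  assume "x +o D = y +o D"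
  moreover have "x \<in> x +o D" by (simp add: mem_coset D_mem)
  ultimately show "x - y \<in> D" by (simp add: mem_coset)
next
  assume *: "x - y \<in> D"
  show "x +o D = y +o D"
  proof (rule Set.set_eqI)
    fix z
    have "z - y \<in> D" if "z - x \<in> D" using D_mem(2)[OF that *] by simp
    moreover have "z - x \<in> D" if "z - y \<in> D" using D_mem(4)[OF that *] by simp
    ultimately show "z \<in> x +o D \<longleftrightarrow> z \<in> y +o D" by (auto simp: mem_coset)
  qed
qed

lemma coset_zero: "0 +o D = D"
  by (auto simp: mem_coset)

lemma coset_eq_D: "x +o D = D \<longleftrightarrow> x \<in> D"
  using coset_eq_iff[of x 0] by (simp add: coset_zero)

lemma coset_add: "(x +o D) + (y +o D) = (x + y) +o D"
proof -
  have "D + D = D"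
    using D_mem(1,2) unfolding set_plus_def by force
  then show ?thesis by (simp add: set_plus_rearrange)
qed

lemma coset_scale_coset: "coset_scale D c (x +o D) = (c *\<^sub>C x) +o D"
proof -
  have "(c *\<^sub>C y) +o D = (c *\<^sub>C x) +o D" if "y \<in> x +o D" for y
    using D_mem(3)[of "y - x" c] that
    by (simp add: coset_eq_iff mem_coset complex_vector.scale_right_diff_distrib)
  moreover have "x \<in> x +o D" by (simp add: mem_coset D_mem)
  ultimately show ?thesis unfolding coset_scale_def by blast
qed

lemma coset_in_Q: "x \<in> W \<Longrightarrow> x +o D \<in> Q"
  by (simp add: quotient_space_def)

lemma D_in_Q: "D \<in> Q"
  using coset_in_Q[of 0] complex_vector.subspace_0[OF subspace_W] by (simp add: coset_zero)

lemma quotient_map_coset: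
  assumes "a \<in> M" "x \<in> W"
  shows "quotient_map W D a (x +o D) = a x +o D"
proof -
  have "a y +o D = a x +o D" if "y \<in> x +o D" for y
  proof -
    have "a (y - x + x) = a (y - x) + a x" by (rule additive[OF assms(1)])
    then have "a y - a x \<in> D" using maps_D[OF assms(1), of "y - x"] that by (simp add: mem_coset)
    then show ?thesis by (simp add: coset_eq_iff)
  qed
  then have "(\<Union>y\<in>x +o D. a y +o D) = (\<Union>y\<in>x +o D. a x +o D)"
    by (rule SUP_cong[OF HOL.refl])
  moreover have "x \<in> x +o D" by (simp add: mem_coset D_mem)
  ultimately have "(\<Union>y\<in>x +o D. a y +o D) = a x +o D"
    by blast
  then show ?thesis
    using assms(2) by (simp add: quotient_map_def coset_in_Q)
qed

text \<open>
  A linear map of \<open>W / D\<close> can be given by any choice of representatives \<open>h\<close> that is linear modulo \<open>D\<close>;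
  this reduces the ring operations on maps to computations in the algebra.
\<close>

lemma linear_mapsI:
  assumes "g \<in> extensional Q" "\<And>x. x \<in> W \<Longrightarrow> g (x +o D) = h x +o D" "\<And>x. x \<in> W \<Longrightarrow> h x \<in> W"
    and "\<And>x y. x \<in> W \<Longrightarrow> y \<in> W \<Longrightarrow> h (x + y) - (h x + h y) \<in> D"
    and "\<And>c x. x \<in> W \<Longrightarrow> h (c *\<^sub>C x) - c *\<^sub>C h x \<in> D"
  shows "g \<in> carrier R"
  using assms
  by (auto simp: quotient_linear_ring_def quotient_linear_maps_def PiE_iff quotient_space_def coset_add
      coset_scale_coset coset_eq_iff complex_vector.subspace_add[OF subspace_W]
      complex_vector.subspace_scale[OF subspace_W])

lemma linear_mapsE:
  assumes "g \<in> carrier R"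
  obtains h where "\<And>x. x \<in> W \<Longrightarrow> g (x +o D) = h x +o D" "\<And>x. x \<in> W \<Longrightarrow> h x \<in> W"
    and "\<And>x y. x \<in> W \<Longrightarrow> y \<in> W \<Longrightarrow> h (x + y) - (h x + h y) \<in> D"
    and "\<And>c x. x \<in> W \<Longrightarrow> h (c *\<^sub>C x) - c *\<^sub>C h x \<in> D"
    and "g \<in> extensional Q"
proof -
  have g: "g \<in> Q \<rightarrow>\<^sub>E Q" "\<And>X Y. X \<in> Q \<Longrightarrow> Y \<in> Q \<Longrightarrow> g (X + Y) = g X + g Y"
    "\<And>c X. X \<in> Q \<Longrightarrow> g (coset_scale D c X) = coset_scale D c (g X)"
    using assms by (auto simp: quotient_linear_ring_def quotient_linear_maps_def)
  have "\<exists>y. y \<in> W \<and> g (x +o D) = y +o D" if "x \<in> W" for x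
    using PiE_mem[OF g(1) coset_in_Q[OF that]] by (auto simp: quotient_space_def)
  then obtain h where h: "\<And>x. x \<in> W \<Longrightarrow> h x \<in> W \<and> g (x +o D) = h x +o D" by metis
  show ?thesis
  proof (rule that[of h])
    fix x y assume "x \<in> W" "y \<in> W"
    then show "h (x + y) - (h x + h y) \<in> D"
      using g(2)[of "x +o D" "y +o D"] h complex_vector.subspace_add[OF subspace_W]
      by (simp add: coset_in_Q coset_add coset_eq_iff)
  next
    fix c x assume "x \<in> W"
    then show "h (c *\<^sub>C x) - c *\<^sub>C h x \<in> D"
      using g(3)[of "x +o D" c] h complex_vector.subspace_scale[OF subspace_W]
      by (simp add: coset_in_Q coset_scale_coset coset_eq_iff)
  qed (use g(1) h in \<open>auto simp: PiE_iff\<close>)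
qed

lemma quotient_map_carrier: "a \<in> M \<Longrightarrow> quotient_map W D a \<in> carrier R"
  by (rule linear_mapsI[where h = a])
    (simp_all add: quotient_map_coset maps_W additive homogeneous D_mem, simp add: quotient_map_def)

lemma zero_apply: "X \<in> Q \<Longrightarrow> \<zero>\<^bsub>R\<^esub> X = D"
  by (simp add: quotient_linear_ring_def)

lemma add_apply: "X \<in> Q \<Longrightarrow> (g \<oplus>\<^bsub>R\<^esub> h) X = g X + h X"
  by (simp add: quotient_linear_ring_def)

lemma mult_apply: "X \<in> Q \<Longrightarrow> (g \<otimes>\<^bsub>R\<^esub> h) X = g (h X)"
  by (simp add: quotient_linear_ring_def compose_def)

lemma extensional_ops: "\<zero>\<^bsub>R\<^esub> \<in> extensional Q" "g \<oplus>\<^bsub>R\<^esub> h \<in> extensional Q" "g \<otimes>\<^bsub>R\<^esub> h \<in> extensional Q"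
  by (simp_all add: quotient_linear_ring_def)

lemma zero_carrier: "\<zero>\<^bsub>R\<^esub> \<in> carrier R"
  by (rule linear_mapsI[where h = "\<lambda>x. 0"])
    (simp_all add: extensional_ops zero_apply coset_in_Q coset_zero D_mem complex_vector.subspace_0[OF subspace_W])

lemma add_carrier:
  assumes "g \<in> carrier R" "h \<in> carrier R"
  shows "g \<oplus>\<^bsub>R\<^esub> h \<in> carrier R"
proof -
  obtain g' where g': "\<And>x. x \<in> W \<Longrightarrow> g (x +o D) = g' x +o D" "\<And>x. x \<in> W \<Longrightarrow> g' x \<in> W"
    "\<And>x y. x \<in> W \<Longrightarrow> y \<in> W \<Longrightarrow> g' (x + y) - (g' x + g' y) \<in> D"
    "\<And>c x. x \<in> W \<Longrightarrow> g' (c *\<^sub>C x) - c *\<^sub>C g' x \<in> D"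
    using assms(1) by (elim linear_mapsE) blast
  obtain h' where h': "\<And>x. x \<in> W \<Longrightarrow> h (x +o D) = h' x +o D" "\<And>x. x \<in> W \<Longrightarrow> h' x \<in> W"
    "\<And>x y. x \<in> W \<Longrightarrow> y \<in> W \<Longrightarrow> h' (x + y) - (h' x + h' y) \<in> D"
    "\<And>c x. x \<in> W \<Longrightarrow> h' (c *\<^sub>C x) - c *\<^sub>C h' x \<in> D"
    using assms(2) by (elim linear_mapsE) blast
  show ?thesis
  proof (rule linear_mapsI[where h = "\<lambda>x. g' x + h' x"])
    fix x y assume "x \<in> W" "y \<in> W"
    then show "g' (x + y) + h' (x + y) - (g' x + h' x + (g' y + h' y)) \<in> D"
      using D_mem(2)[OF g'(3) h'(3), of x y x y] by (simp add: algebra_simps)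
  next
    fix c x assume "x \<in> W"
    then show "g' (c *\<^sub>C x) + h' (c *\<^sub>C x) - c *\<^sub>C (g' x + h' x) \<in> D"
      using D_mem(2)[OF g'(4) h'(4), of x x c c]
      by (simp add: algebra_simps star_algebra_class.scaleC_add_right)
  qed (simp_all add: extensional_ops add_apply coset_in_Q g' h' coset_add
      complex_vector.subspace_add[OF subspace_W])
qed

lemma Q_add: "X \<in> Q \<Longrightarrow> Y \<in> Q \<Longrightarrow> X + Y \<in> Q"
  unfolding quotient_space_def
  by (auto simp: coset_add intro!: imageI complex_vector.subspace_add[OF subspace_W])

lemma Q_scale: "X \<in> Q \<Longrightarrow> coset_scale D c X \<in> Q"
  unfolding quotient_space_def
  by (auto simp: coset_scale_coset intro!: imageI complex_vector.subspace_scale[OF subspace_W])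

lemma mult_carrier:
  assumes "g \<in> carrier R" "h \<in> carrier R"
  shows "g \<otimes>\<^bsub>R\<^esub> h \<in> carrier R"
  using assms
  by (auto simp: quotient_linear_ring_def quotient_linear_maps_def PiE_iff compose_def Q_add Q_scale)

text \<open>
  The additive inverse of a ring is defined by unique description, so its value must be identified
  before elements of the generated ring can be evaluated.
\<close>

lemma a_inv_eq:
  assumes "g \<in> carrier R"
  shows "\<ominus>\<^bsub>R\<^esub> g = (\<lambda>X\<in>Q. coset_scale D (-1) (g X))" (is "_ = ?n") and "\<ominus>\<^bsub>R\<^esub> g \<in> carrier R"
proof -
  obtain g' where g': "\<And>x. x \<in> W \<Longrightarrow> g (x +o D) = g' x +o D" "\<And>x. x \<in> W \<Longrightarrow> g' x \<in> W"
    "\<And>x y. x \<in> W \<Longrightarrow> y \<in> W \<Longrightarrow> g' (x + y) - (g' x + g' y) \<in> D"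
    "\<And>c x. x \<in> W \<Longrightarrow> g' (c *\<^sub>C x) - c *\<^sub>C g' x \<in> D"
    using assms(1) by (elim linear_mapsE) blast
  have n: "?n (x +o D) = (- g' x) +o D" if "x \<in> W" for x
    using that by (simp add: coset_in_Q g' coset_scale_coset scaleC_minus_one)
  have carrier: "?n \<in> carrier R"
  proof (rule linear_mapsI[where h = "\<lambda>x. - g' x"])
    fix x y assume "x \<in> W" "y \<in> W"
    then show "- g' (x + y) - (- g' x + - g' y) \<in> D"
      using D_mem(5)[OF g'(3), of x y] by (simp add: algebra_simps)
  next
    fix c x assume "x \<in> W"
    then show "- g' (c *\<^sub>C x) - c *\<^sub>C - g' x \<in> D"
      using D_mem(5)[OF g'(4), of x c] by (simp add: algebra_simps)
  qed (simp_all add: n g' complex_vector.subspace_neg[OF subspace_W] del: restrict_apply)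
  have pointwise: "?n X + g X = D" "g X + ?n X = D" if X: "X \<in> Q" for X
  proof -
    obtain x where x: "x \<in> W" "X = x +o D" using X by (auto simp: quotient_space_def)
    show "?n X + g X = D" "g X + ?n X = D"
      unfolding x(2) n[OF x(1)] g'(1)[OF x(1)] by (simp_all add: coset_add coset_zero)
  qed
  have sum: "?n \<oplus>\<^bsub>R\<^esub> g = \<zero>\<^bsub>R\<^esub>" "g \<oplus>\<^bsub>R\<^esub> ?n = \<zero>\<^bsub>R\<^esub>"
    by (rule extensionalityI[OF extensional_ops(2,1)],
        simp only: add_apply zero_apply pointwise)+
  have unique: "y = ?n" if y: "y \<in> carrier R" "g \<oplus>\<^bsub>R\<^esub> y = \<zero>\<^bsub>R\<^esub>" for y
  proof -
    obtain y' where y': "\<And>x. x \<in> W \<Longrightarrow> y (x +o D) = y' x +o D" "y \<in> extensional Q"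
      using y(1) by (elim linear_mapsE) blast
    show ?thesis
    proof (rule extensionalityI[OF y'(2) restrict_extensional])
      fix X assume "X \<in> Q"
      then obtain x where x: "x \<in> W" "X = x +o D" by (auto simp: quotient_space_def)
      have "g X + y X = D"
        using fun_cong[OF y(2), of X] \<open>X \<in> Q\<close> by (simp add: add_apply zero_apply)
      then have "g' x + y' x \<in> D"
        using x by (simp add: g' y' coset_add coset_eq_D)
      then show "y X = ?n X"
        unfolding x(2) n[OF x(1)] using x(1) by (simp add: y' coset_eq_iff add.commute)
    qed
  qed
  have "\<ominus>\<^bsub>R\<^esub> g = (THE y. y \<in> carrier R \<and> g \<oplus>\<^bsub>R\<^esub> y = \<zero>\<^bsub>R\<^esub> \<and> y \<oplus>\<^bsub>R\<^esub> g = \<zero>\<^bsub>R\<^esub>)"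
    by (simp add: a_inv_def m_inv_def)
  also have "\<dots> = ?n"
    by (rule the_equality, intro conjI carrier sum, elim conjE, rule unique)
  finally show eq: "\<ominus>\<^bsub>R\<^esub> g = ?n" .
  show "\<ominus>\<^bsub>R\<^esub> g \<in> carrier R" unfolding eq by (rule carrier)
qed

lemma subspace_iterated_images: "csubspace (iterated_images r)"
  by (cases r) (simp_all add: subspace_W)

lemma iterated_images_Suc_mem: "a \<in> M \<Longrightarrow> x \<in> iterated_images r \<Longrightarrow> a x \<in> iterated_images (Suc r)"
  by (auto intro: complex_vector.span_base)

lemma iterated_images_dec: "iterated_images (Suc r) \<subseteq> iterated_images r"
proof (induction r)
  case 0
  have "{a x | a x. a \<in> M \<and> x \<in> W} \<subseteq> W" using maps_W by blast
  then show ?case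
    unfolding iterated_images.simps by (rule complex_vector.span_minimal[OF _ subspace_W])
next
  case (Suc r)
  then show ?case
    unfolding iterated_images.simps(2)[of r] iterated_images.simps(2)[of "Suc r"]
    by (intro complex_vector.span_mono) blast
qed

lemma iterated_images_antimono: "r \<le> s \<Longrightarrow> iterated_images s \<subseteq> iterated_images r"
  by (rule lift_Suc_antimono_le[of iterated_images, OF iterated_images_dec])

lemma iterated_images_subset_W: "iterated_images r \<subseteq> W"
  using iterated_images_antimono[of 0 r] by simp

lemma iterated_images_coset: "x \<in> iterated_images r \<Longrightarrow> x +o D \<in> Q"
  using iterated_images_subset_W coset_in_Q by blast

text \<open>
  The filtration of \<open>W / D\<close> by the iterated images makes degrees available: \<open>g\<close> has degree at least \<open>j\<close>
  if it moves every step of the filtration \<open>j\<close> steps further. Degrees add up under composition, so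
  the \<open>l\<close>-th power of the generated ring has degree at least \<open>l\<close>.
\<close>

definition raises :: "nat \<Rightarrow> ('a set \<Rightarrow> 'a set) \<Rightarrow> bool" where
  "raises j g \<longleftrightarrow> g \<in> carrier R \<and>
     (\<forall>r. \<forall>x\<in>iterated_images r. \<exists>y\<in>iterated_images (j + r). g (x +o D) = y +o D)"

lemma raisesE:
  assumes "raises j g" "x \<in> iterated_images r"
  obtains y where "y \<in> iterated_images (j + r)" "g (x +o D) = y +o D"
  using assms unfolding raises_def by meson

lemma raises_zero: "raises j \<zero>\<^bsub>R\<^esub>"
  unfolding raises_def
proof (intro conjI allI ballI zero_carrier)
  fix r x assume "x \<in> iterated_images r"
  then have "\<zero>\<^bsub>R\<^esub> (x +o D) = 0 +o D"
    by (simp add: zero_apply iterated_images_coset coset_zero)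
  then show "\<exists>y\<in>iterated_images (j + r). \<zero>\<^bsub>R\<^esub> (x +o D) = y +o D"
    using complex_vector.subspace_0[OF subspace_iterated_images] by blast
qed

lemma raises_a_inv:
  assumes "raises j g"
  shows "raises j (\<ominus>\<^bsub>R\<^esub> g)"
  unfolding raises_def
proof (intro conjI allI ballI)
  show "\<ominus>\<^bsub>R\<^esub> g \<in> carrier R" using assms a_inv_eq(2) by (simp only: raises_def)
  fix r x assume x: "x \<in> iterated_images r"
  then obtain y where y: "y \<in> iterated_images (j + r)" "g (x +o D) = y +o D"
    by (rule raisesE[OF assms])
  have "(\<ominus>\<^bsub>R\<^esub> g) (x +o D) = (- 1 *\<^sub>C y) +o D"
    using assms y by (simp add: raises_def a_inv_eq iterated_images_coset[OF x] coset_scale_coset)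
  then show "\<exists>y\<in>iterated_images (j + r). (\<ominus>\<^bsub>R\<^esub> g) (x +o D) = y +o D"
    using complex_vector.subspace_scale[OF subspace_iterated_images y(1)] by blast
qed

lemma raises_add:
  assumes "raises j g" "raises j h"
  shows "raises j (g \<oplus>\<^bsub>R\<^esub> h)"
  unfolding raises_def
proof (intro conjI allI ballI)
  show "g \<oplus>\<^bsub>R\<^esub> h \<in> carrier R" using assms by (simp add: raises_def add_carrier)
  fix r x assume x: "x \<in> iterated_images r"
  obtain y where y: "y \<in> iterated_images (j + r)" "g (x +o D) = y +o D"
    by (rule raisesE[OF assms(1) x])
  obtain z where z: "z \<in> iterated_images (j + r)" "h (x +o D) = z +o D"
    by (rule raisesE[OF assms(2) x])
  have "(g \<oplus>\<^bsub>R\<^esub> h) (x +o D) = (y + z) +o D"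
    using y z by (simp add: add_apply iterated_images_coset[OF x] coset_add)
  then show "\<exists>y\<in>iterated_images (j + r). (g \<oplus>\<^bsub>R\<^esub> h) (x +o D) = y +o D"
    using complex_vector.subspace_add[OF subspace_iterated_images y(1) z(1)] by blast
qed

lemma raises_mult:
  assumes "raises i g" "raises j h"
  shows "raises (i + j) (g \<otimes>\<^bsub>R\<^esub> h)"
  unfolding raises_def
proof (intro conjI allI ballI)
  show "g \<otimes>\<^bsub>R\<^esub> h \<in> carrier R" using assms by (simp add: raises_def mult_carrier)
  fix r x assume x: "x \<in> iterated_images r"
  obtain y where y: "y \<in> iterated_images (j + r)" "h (x +o D) = y +o D"
    by (rule raisesE[OF assms(2) x])
  obtain z where z: "z \<in> iterated_images (i + (j + r))" "g (y +o D) = z +o D"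
    by (rule raisesE[OF assms(1) y(1)])
  have "(g \<otimes>\<^bsub>R\<^esub> h) (x +o D) = z +o D"
    using y z by (simp add: mult_apply iterated_images_coset[OF x])
  then show "\<exists>y\<in>iterated_images (i + j + r). (g \<otimes>\<^bsub>R\<^esub> h) (x +o D) = y +o D"
    using z(1) by (auto simp: add.assoc)
qed

lemma raises_antimono:
  assumes "raises j g" "i \<le> j"
  shows "raises i g"
proof -
  have "iterated_images (j + r) \<subseteq> iterated_images (i + r)" for r
    using assms(2) by (intro iterated_images_antimono) simp
  then show ?thesis using assms(1) unfolding raises_def by blast
qed

lemma raises_A: "g \<in> A \<Longrightarrow> raises 1 g"
proof (induction rule: generate_rng.induct)
  case (incl g)
  then obtain a where a: "a \<in> M" "g = quotient_map W D a" by blast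
  show ?case
    unfolding raises_def
  proof (intro conjI allI ballI)
    fix r x assume x: "x \<in> iterated_images r"
    then have "x \<in> W" using iterated_images_subset_W by blast
    then have "g (x +o D) = a x +o D"
      unfolding a(2) by (rule quotient_map_coset[OF a(1)])
    then show "\<exists>y\<in>iterated_images (1 + r). g (x +o D) = y +o D"
      using iterated_images_Suc_mem[OF a(1) x] by auto
  qed (simp add: a quotient_map_carrier)
next
  case (mult g h)
  then show ?case using raises_mult[of 1 g 1 h] raises_antimono[of 2 _ 1] by (simp add: numeral_2_eq_2)
qed (simp_all add: raises_zero raises_a_inv raises_add)

lemma raises_rng_power: "g \<in> rng_power R A (Suc l) \<Longrightarrow> raises (Suc l) g"
proof (induction l arbitrary: g)
  case 0
  then show ?case using raises_A by simp
next
  case (Suc l)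
  from Suc.prems have "g \<in> ideal_prod R (rng_power R A (Suc l)) A" by simp
  then show ?case
  proof (induction rule: ideal_prod.induct)
    case (prod g h)
    then show ?case using raises_mult[OF Suc.IH raises_A, of g h] by simp
  qed (simp add: raises_add)
qed

lemma zero_in_rng_power: "\<zero>\<^bsub>R\<^esub> \<in> rng_power R A (Suc l)"
proof (induction l)
  case 0
  show ?case by (simp add: generate_rng.zero)
next
  case (Suc l)
  have "\<zero>\<^bsub>R\<^esub> \<otimes>\<^bsub>R\<^esub> \<zero>\<^bsub>R\<^esub> = \<zero>\<^bsub>R\<^esub>"
    by (rule extensionalityI[OF extensional_ops(3,1)]) (simp add: mult_apply zero_apply D_in_Q)
  then show ?case
    using ideal_prod.prod[where R = R, OF Suc generate_rng.zero[of R "quotient_map W D ` M"]] by simp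
qed

text \<open>
  If the \<open>l\<close>-th iterated image lies in \<open>D\<close>, a map of degree at least \<open>l\<close> is zero. Conversely, let \<open>Z j\<close>
  be the subspace annihilated by the power \<open>j + 1\<close> of the ring. A generator maps \<open>Z (j + 1)\<close> into
  \<open>Z j\<close>, so starting from \<open>Z l = W\<close> the iterated images descend through the \<open>Z j\<close> and reach \<open>D\<close>.
\<close>

theorem nilpotent_iff: "nilpotent_rng R A \<longleftrightarrow> (\<exists>l. iterated_images l \<subseteq> D)"
proof
  assume "\<exists>l. iterated_images l \<subseteq> D"
  then obtain l where "iterated_images l \<subseteq> D" by blast
  \<comment> \<open>passing to \<open>Suc l\<close> ensures a positive exponent, which nilpotency demands\<close>
  then have l: "iterated_images (Suc l) \<subseteq> D" using iterated_images_dec[of l] by blast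
  have "g = \<zero>\<^bsub>R\<^esub>" if "g \<in> rng_power R A (Suc l)" for g
  proof -
    have g: "raises (Suc l) g" by (rule raises_rng_power[OF that])
    then have ext: "g \<in> extensional Q"
      by (auto simp: raises_def quotient_linear_ring_def quotient_linear_maps_def PiE_iff)
    show ?thesis
    proof (rule extensionalityI[OF ext extensional_ops(1)])
      fix X assume X: "X \<in> Q"
      then obtain x where x: "x \<in> iterated_images 0" "X = x +o D" by (auto simp: quotient_space_def)
      then obtain y where "y \<in> iterated_images (Suc l + 0)" "g X = y +o D"
        using g unfolding raises_def by blast
      then have "y \<in> D" "g X = y +o D" using l by auto
      then show "g X = \<zero>\<^bsub>R\<^esub> X" by (simp add: coset_eq_D zero_apply X)
    qed
  qed
  then have "rng_power R A (Suc l) = {\<zero>\<^bsub>R\<^esub>}" using zero_in_rng_power[of l] by blast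
  then show "nilpotent_rng R A" unfolding nilpotent_rng_def by (metis le_add1 plus_1_eq_Suc)
next
  assume "nilpotent_rng R A"
  then obtain l where l: "rng_power R A (Suc l) = {\<zero>\<^bsub>R\<^esub>}"
    unfolding nilpotent_rng_def by (metis Suc_le_D One_nat_def)
  define Z where "Z j = {x \<in> W. \<forall>g\<in>rng_power R A (Suc j). g (x +o D) = D}" for j
  have Z_annihilates: "g (x +o D) = D" if "x \<in> Z j" "g \<in> rng_power R A (Suc j)" for g x j
  proof -
    from that(1) have "\<forall>g\<in>rng_power R A (Suc j). g (x +o D) = D" by (simp add: Z_def)
    from this that(2) show ?thesis by (rule bspec)
  qed
  have Z: "csubspace (Z j)" for j
    unfolding complex_vector.subspace_def
  proof (intro conjI ballI allI)
    have car: "g \<in> carrier R" if "g \<in> rng_power R A (Suc j)" for g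
      using raises_rng_power[OF that] by (simp add: raises_def)
    have gadd: "g (X + Y) = g X + g Y" and gscale: "g (coset_scale D c X) = coset_scale D c (g X)"
      if "g \<in> rng_power R A (Suc j)" "X \<in> Q" "Y \<in> Q" for g X Y c
      using car[OF that(1)] that(2,3) by (auto simp: quotient_linear_ring_def quotient_linear_maps_def)
    have DD: "D + D = D" "coset_scale D c D = D" for c
      using coset_add[of 0 0] coset_scale_coset[of c 0] by (simp_all add: coset_zero)
    have zero_img: "g D = D" if g: "g \<in> rng_power R A (Suc j)" for g
    proof -
      obtain y where "g D = y +o D"
        using raises_rng_power[OF g] complex_vector.subspace_0[OF subspace_W]
        unfolding raises_def by (metis coset_zero iterated_images.simps(1))
      then show ?thesis
        using gscale[OF g D_in_Q D_in_Q, of 0] by (simp add: DD coset_scale_coset coset_zero)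
    qed
    show "0 \<in> Z j"
      using complex_vector.subspace_0[OF subspace_W]
      by (auto simp: Z_def coset_zero D_in_Q zero_img)
    show "x + y \<in> Z j" if "x \<in> Z j" "y \<in> Z j" for x y
    proof -
      have W: "x \<in> W" "y \<in> W" using that by (simp_all add: Z_def)
      have "g ((x + y) +o D) = D" if g: "g \<in> rng_power R A (Suc j)" for g
      proof -
        have "g (x +o D) = D" "g (y +o D) = D"
          by (rule Z_annihilates[OF \<open>x \<in> Z j\<close> g], rule Z_annihilates[OF \<open>y \<in> Z j\<close> g])
        then show ?thesis
          using gadd[OF g coset_in_Q[OF W(1)] coset_in_Q[OF W(2)]] by (simp add: coset_add DD(1))
      qed
      then show ?thesis
        using W complex_vector.subspace_add[OF subspace_W] by (simp add: Z_def)
    qed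
    show "c *\<^sub>C x \<in> Z j" if "x \<in> Z j" for c x
    proof -
      have W: "x \<in> W" using that by (simp add: Z_def)
      have "g ((c *\<^sub>C x) +o D) = D" if g: "g \<in> rng_power R A (Suc j)" for g
      proof -
        have "g (x +o D) = D" by (rule Z_annihilates[OF \<open>x \<in> Z j\<close> g])
        then show ?thesis
          using gscale[OF g coset_in_Q[OF W] D_in_Q, of c] by (simp add: coset_scale_coset DD(2))
      qed
      then show ?thesis
        using W complex_vector.subspace_scale[OF subspace_W] by (simp add: Z_def)
    qed
  qed
  have "iterated_images r \<subseteq> Z (l - r)" if "r \<le> l" for r
    using that
  proof (induction r)
    case 0
    show ?case by (auto simp: Z_def l zero_apply coset_in_Q)
  next
    case (Suc r)
    then have IH: "iterated_images r \<subseteq> Z (Suc (l - Suc r))" by (simp add: Suc_diff_Suc)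
    have "a x \<in> Z (l - Suc r)" if a: "a \<in> M" and x: "x \<in> iterated_images r" for a x
      unfolding Z_def
    proof (intro CollectI conjI ballI)
      have xW: "x \<in> W" using x iterated_images_subset_W by blast
      then show "a x \<in> W" by (rule maps_W[OF a])
      fix g assume "g \<in> rng_power R A (Suc (l - Suc r))"
      then have "g \<otimes>\<^bsub>R\<^esub> quotient_map W D a \<in> rng_power R A (Suc (Suc (l - Suc r)))"
        using a by (auto intro: ideal_prod.prod generate_rng.incl)
      then have "(g \<otimes>\<^bsub>R\<^esub> quotient_map W D a) (x +o D) = D"
        using IH x by (intro Z_annihilates[of x "Suc (l - Suc r)"]) blast+
      then show "g (a x +o D) = D"
        using xW by (simp add: mult_apply coset_in_Q quotient_map_coset[OF a])
    qed
    then show ?case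
      unfolding iterated_images.simps by (intro complex_vector.span_minimal Z) blast
  qed
  from this[of l] have 0: "iterated_images l \<subseteq> Z 0" by simp
  have "a x \<in> D" if "a \<in> M" "x \<in> iterated_images l" for a x
  proof -
    have "quotient_map W D a \<in> A" using that(1) by (auto intro: generate_rng.incl)
    then have "quotient_map W D a (x +o D) = D"
      using 0 that(2) by (intro Z_annihilates[of x 0]) auto
    moreover have "x \<in> W" using that(2) iterated_images_subset_W by blast
    ultimately have "a x +o D = D" by (simp add: quotient_map_coset[OF that(1)])
    then show ?thesis by (simp only: coset_eq_D)
  qed
  then have "iterated_images (Suc l) \<subseteq> D"
    unfolding iterated_images.simps by (intro complex_vector.span_minimal subspace_D) blast
  then show "\<exists>l. iterated_images l \<subseteq> D" by blast
qed

end

section \<open>The generators and the core\<close>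

locale graph_cstar = fin_digraph E for E :: "('v, 'e) pre_digraph" +
  fixes P :: "'v \<Rightarrow> 'a::cstar_algebra" and S :: "'e \<Rightarrow> 'a"
  assumes no_sinks: "v \<in> verts E \<Longrightarrow> out_arcs E v \<noteq> {}"
    and graph_algebra: "graph_cstar_algebra E P S"
begin

abbreviation F :: "nat \<Rightarrow> 'a set" where "F \<equiv> core_F E P S"
abbreviation D :: "'a set" where "D \<equiv> diag_D0 E P"
abbreviation \<phi> :: "'a \<Rightarrow> 'a" where "\<phi> \<equiv> shift E S"
abbreviation \<U> :: "'a set" where "\<U> \<equiv> graph_unitaries E P"
abbreviation lam :: "'a \<Rightarrow> 'a \<Rightarrow> 'a" where "lam \<equiv> lambda_endo E P S"
abbreviation cyc :: "'a \<Rightarrow> nat \<Rightarrow> 'a" where "cyc \<equiv> cocycle E P S"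

definition unit_elem :: 'a ("\<I>") where
  "\<I> = (\<Sum>v\<in>verts E. P v)"

definition vertex_commutant :: "'a set" where
  "vertex_commutant = {x. \<forall>v\<in>verts E. x * P v = P v * x}"

lemma unit_elem_mult [simp]: "\<I> * x = x" "x * \<I> = x"
  using ck_identity[OF fin_digraph_axioms graph_algebra] by (auto simp: is_identity_def unit_elem_def)

lemma is_identity_iff: "is_identity e \<longleftrightarrow> e = \<I>"
  by (metis is_identity_def unit_elem_mult)

lemma ck: "ck_family E P S"
  using graph_algebra by (simp add: graph_cstar_algebra_def)

lemma star_P [simp]: "v \<in> verts E \<Longrightarrow> star (P v) = P v"
  using ck by (simp add: ck_relations_def)

lemma P_mult_P: "v \<in> verts E \<Longrightarrow> w \<in> verts E \<Longrightarrow> P v * P w = (if v = w then P v else 0)"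
  using ck by (auto simp: ck_relations_def)

lemma star_S_S: "e \<in> arcs E \<Longrightarrow> f \<in> arcs E \<Longrightarrow> star (S e) * S f = (if e = f then P (head E e) else 0)"
  using ck by (auto simp: ck_relations_def)

lemma S_star_S_S: "e \<in> arcs E \<Longrightarrow> S e * star (S e) * S e = S e"
  using ck by (simp add: ck_relations_def)

lemma S_P_head: "e \<in> arcs E \<Longrightarrow> S e * P (head E e) = S e"
  using S_star_S_S[of e] star_S_S[of e e] by (simp add: mult.assoc)

lemma P_S_tail:
  assumes "e \<in> arcs E"
  shows "P (tail E e) * S e = S e"
proof -
  have "P (tail E e) * (S e * star (S e)) = S e * star (S e)"
    using ck assms by (simp add: ck_relations_def)
  then have "P (tail E e) * (S e * star (S e) * S e) = S e * star (S e) * S e"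
    by (simp add: mult.assoc[symmetric])
  then show ?thesis using assms by (simp add: S_star_S_S)
qed

lemma P_S: "e \<in> arcs E \<Longrightarrow> v \<in> verts E \<Longrightarrow> P v * S e = (if v = tail E e then S e else 0)"
  using P_S_tail[of e] P_mult_P[of v "tail E e"] by (metis mult.assoc mult_zero_left tail_in_verts)

lemma S_P: "e \<in> arcs E \<Longrightarrow> v \<in> verts E \<Longrightarrow> S e * P v = (if v = head E e then S e else 0)"
  using S_P_head[of e] P_mult_P[of "head E e" v] by (metis mult.assoc mult_zero_right head_in_verts)

lemma star_S_P: "e \<in> arcs E \<Longrightarrow> v \<in> verts E \<Longrightarrow> star (S e) * P v = (if v = tail E e then star (S e) else 0)"
  using arg_cong[OF P_S[of e v], of star] by (simp add: star_algebra_class.star_mult star_zero split: if_splits)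

lemma P_sum: "v \<in> verts E \<Longrightarrow> P v = (\<Sum>e\<in>out_arcs E v. S e * star (S e))"
  using ck no_sinks by (auto simp: ck_relations_def)

text \<open>
  Without sinks every vertex projection is the sum of the range projections of the edges that the
  vertex emits.
\<close>

lemma sum_S_star_S: "(\<Sum>e\<in>arcs E. S e * star (S e)) = \<I>"
proof -
  have "\<I> = (\<Sum>v\<in>verts E. \<Sum>e\<in>out_arcs E v. S e * star (S e))"
    by (simp add: unit_elem_def P_sum)
  also have "\<dots> = (\<Sum>e\<in>(\<Union>v\<in>verts E. out_arcs E v). S e * star (S e))"
    by (rule sum.UNION_disjoint[symmetric]) auto
  also have "(\<Union>v\<in>verts E. out_arcs E v) = arcs E" by auto
  finally show ?thesis ..
qed

lemma star_unit [simp]: "star \<I> = \<I>"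
  by (simp add: unit_elem_def star_sum)

lemma star_S_S_mult:
  "e \<in> arcs E \<Longrightarrow> f \<in> arcs E \<Longrightarrow> star (S e) * (S f * x) = (if e = f then P (head E e) * x else 0)"
  by (simp add: mult.assoc[symmetric] star_S_S)

lemma csubspace_F: "csubspace (F k)" and csubspace_D: "csubspace D"
  by (simp_all add: core_F_def diag_D0_def)

lemma P_in_D: "v \<in> verts E \<Longrightarrow> P v \<in> D"
  by (simp add: diag_D0_def complex_vector.span_base)

lemma core_F_0: "F 0 = D"
proof -
  let ?B = "{path_elem P S \<mu> * star (path_elem P S \<nu>) | \<mu> \<nu>. \<mu> \<in> paths E 0 \<and> \<nu> \<in> paths E 0}"
  have paths: "paths E 0 = (\<lambda>v. (v, [])) ` verts E"
    by (auto simp: paths_def awalk_Nil_iff)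
  have "?B \<subseteq> D"
    by (auto simp: paths P_mult_P complex_vector.subspace_0[OF csubspace_D] P_in_D)
  then have "cspan ?B \<subseteq> D"
    by (rule complex_vector.span_minimal[OF _ csubspace_D])
  moreover have "P ` verts E \<subseteq> ?B"
    by (force simp: paths P_mult_P)
  then have "D \<subseteq> cspan ?B"
    unfolding diag_D0_def by (rule complex_vector.span_mono)
  ultimately show ?thesis
    unfolding core_F_def by blast
qed

lemma path_elem_start: "path_elem P S (v, e # p) = path_elem P S (w, e # p)"
  by (induction p arbitrary: e) simp_all

lemma S_path_elem:
  assumes "e \<in> arcs E" "awalk (head E e) p w"
  shows "S e * path_elem P S (head E e, p) = path_elem P S (tail E e, e # p)"
proof (cases p)
  case Nil
  then show ?thesis using assms by (simp add: S_P_head)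
next
  case (Cons f q)
  then show ?thesis using path_elem_start[of "head E e" f q "tail E e"] by simp
qed

lemma P_path_elem:
  assumes "v \<in> verts E" "awalk w p z"
  shows "P v * path_elem P S (w, p) = (if v = w then path_elem P S (w, p) else 0)"
proof (cases p)
  case Nil then show ?thesis using assms by (auto simp: P_mult_P awalk_Nil_iff)
next
  case (Cons e q)
  then have "e \<in> arcs E" "w = tail E e" using assms by (auto simp: awalk_Cons_iff)
  then show ?thesis
    using Cons assms(1) by (cases q) (simp_all add: P_S mult.assoc[symmetric])
qed

text \<open>
  This recursion, with \<open>F 0 = D\<close>, replaces paths by induction on the level: a path of length \<open>k + 1\<close> is
  an edge \<open>e\<close> followed by a path of length \<open>k\<close>, and \<open>S\<^sub>e\<close> annihilates the paths that do not start at the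
  head of \<open>e\<close>.
\<close>

lemma core_F_Suc:
  "F (Suc k) = cspan {S e * x * star (S f) | e f x. e \<in> arcs E \<and> f \<in> arcs E \<and> x \<in> F k}" (is "_ = cspan ?B")
proof (rule antisym)
  show "F (Suc k) \<subseteq> cspan ?B"
    unfolding core_F_def[of E P S "Suc k"]
  proof (rule complex_vector.span_mono, safe)
    fix v p v' p' assume "(v, p) \<in> paths E (Suc k)" "(v', p') \<in> paths E (Suc k)"
    then obtain e q f q' w w' where p: "p = e # q" "p' = f # q'" "length q = k" "length q' = k"
      "e \<in> arcs E" "f \<in> arcs E" "v = tail E e" "v' = tail E f"
      "awalk (head E e) q w" "awalk (head E f) q' w'"
      by (auto simp: paths_def length_Suc_conv awalk_Cons_iff)
    let ?x = "path_elem P S (head E e, q) * star (path_elem P S (head E f, q'))"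
    have "(head E e, q) \<in> paths E k" "(head E f, q') \<in> paths E k"
      using p by (auto simp: paths_def)
    then have "?x \<in> F k"
      unfolding core_F_def by (intro complex_vector.span_base) blast
    moreover have "path_elem P S (v, p) * star (path_elem P S (v', p')) = S e * ?x * star (S f)"
      using p by (simp add: S_path_elem[symmetric] star_algebra_class.star_mult mult.assoc)
    ultimately show "\<exists>e f x. path_elem P S (v, p) * star (path_elem P S (v', p')) = S e * x * star (S f)
        \<and> e \<in> arcs E \<and> f \<in> arcs E \<and> x \<in> F k"
      using p by blast
  qed
  have gen: "S e * x * star (S f) \<in> F (Suc k)" if ef: "e \<in> arcs E" "f \<in> arcs E" and x: "x \<in> F k" for e f x
    using x unfolding core_F_def[of E P S k]
  proof (rule cspan_map_into[where f = "\<lambda>x. S e * x * star (S f)"])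
    fix x assume "x \<in> {path_elem P S \<mu> * star (path_elem P S \<nu>) | \<mu> \<nu>. \<mu> \<in> paths E k \<and> \<nu> \<in> paths E k}"
    then obtain v p v' p' w w' where x: "x = path_elem P S (v, p) * star (path_elem P S (v', p'))"
      "length p = k" "length p' = k" "awalk v p w" "awalk v' p' w'"
      by (auto simp: paths_def)
    have *: "S g * path_elem P S (v, p) = (if v = head E g then path_elem P S (tail E g, g # p) else 0)"
      if "g \<in> arcs E" "awalk v p w" for g v p w
    proof -
      have "S g * path_elem P S (v, p) = S g * (P (head E g) * path_elem P S (v, p))"
        using that(1) by (simp add: S_P_head mult.assoc[symmetric])
      then show ?thesis
        using P_path_elem[OF head_in_verts[OF that(1)] that(2)] S_path_elem[OF that(1), of p w] that(2)
        by auto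
    qed
    have eq: "S e * x * star (S f) = S e * path_elem P S (v, p) * star (S f * path_elem P S (v', p'))"
      by (simp add: x star_algebra_class.star_mult mult.assoc)
    show "S e * x * star (S f) \<in> F (Suc k)"
    proof (cases "v = head E e \<and> v' = head E f")
      case True
      then have "S e * x * star (S f) = path_elem P S (tail E e, e # p) * star (path_elem P S (tail E f, f # p'))"
        unfolding eq using *[OF ef(1) x(4)] *[OF ef(2) x(5)] by simp
      moreover have "(tail E e, e # p) \<in> paths E (Suc k)" "(tail E f, f # p') \<in> paths E (Suc k)"
        using True x ef by (auto simp: paths_def awalk_Cons_iff)
      ultimately show ?thesis
        unfolding core_F_def by (intro complex_vector.span_base) blast
    next
      case False
      then have "S e * x * star (S f) = 0"
        unfolding eq using *[OF ef(1) x(4)] *[OF ef(2) x(5)] by (auto simp: star_zero)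
      then show ?thesis using csubspace_F by (simp add: complex_vector.subspace_0)
    qed
  qed (simp_all add: csubspace_F algebra_simps star_algebra_class.mult_scaleC_left star_algebra_class.mult_scaleC_right)
  show "cspan ?B \<subseteq> F (Suc k)"
    by (rule complex_vector.span_minimal) (use gen csubspace_F in auto)
qed


lemma F_gen: "e \<in> arcs E \<Longrightarrow> f \<in> arcs E \<Longrightarrow> x \<in> F k \<Longrightarrow> S e * x * star (S f) \<in> F (Suc k)"
  unfolding core_F_Suc by (rule complex_vector.span_base) blast

lemma F_Suc_map_into:
  assumes "x \<in> F (Suc k)" "csubspace T"
    and "\<And>e f x. e \<in> arcs E \<Longrightarrow> f \<in> arcs E \<Longrightarrow> x \<in> F k \<Longrightarrow> h (S e * x * star (S f)) \<in> T"
    and "\<And>x y. h (x + y) = h x + h y" "\<And>c x. h (c *\<^sub>C x) = c *\<^sub>C h x"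
  shows "h x \<in> T"
  using assms(1) unfolding core_F_Suc
  by (rule cspan_map_into[where f = h, OF _ assms(2) _ assms(4,5)]) (use assms(3) in blast)

lemmas scaleC_mult = star_algebra_class.mult_scaleC_left star_algebra_class.mult_scaleC_right
lemmas star_simps = star_algebra_class.star_mult star_algebra_class.star_add
  star_algebra_class.star_scaleC star_algebra_class.star_star star_zero star_sum

lemmas F_0_mem = complex_vector.subspace_0[OF csubspace_F]
lemmas F_sum_mem = complex_vector.subspace_sum[OF csubspace_F]

text \<open>
  At level \<open>0\<close> this is the expansion of a vertex projection into range projections.
\<close>

lemma F_Suc_mono: "F k \<subseteq> F (Suc k)"
proof (induction k)
  case 0
  have "P v \<in> F (Suc 0)" if v: "v \<in> verts E" for v
  proof -
    have "S e * star (S e) \<in> F (Suc 0)" if "e \<in> arcs E" for e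
      using F_gen[OF that that, of "P (head E e)" 0] that by (simp add: core_F_0 P_in_D S_P_head)
    then show ?thesis unfolding P_sum[OF v] by (intro F_sum_mem) auto
  qed
  then show ?case
    unfolding core_F_0 unfolding diag_D0_def
    by (intro complex_vector.span_minimal csubspace_F) blast
next
  case (Suc k)
  then show ?case
    unfolding core_F_Suc[of k] core_F_Suc[of "Suc k"] by (intro complex_vector.span_mono) blast
qed

lemma F_mono: "k \<le> l \<Longrightarrow> F k \<subseteq> F l"
  by (rule lift_Suc_mono_le[of F, OF F_Suc_mono])

lemma D_subset_F: "D \<subseteq> F k"
  using F_mono[of 0 k] by (simp add: core_F_0)

lemma P_in_F: "v \<in> verts E \<Longrightarrow> P v \<in> F k"
  using P_in_D D_subset_F by blast

lemma unit_in_F: "\<I> \<in> F k"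
  unfolding unit_elem_def by (intro F_sum_mem P_in_F)

lemma F_star: "x \<in> F k \<Longrightarrow> star x \<in> F k"
proof (induction k arbitrary: x)
  case 0
  then show ?case
    unfolding core_F_0 unfolding diag_D0_def
    by (rule cspan_semilinear_map_into[where f = star and \<sigma> = cnj])
      (auto simp: star_simps P_in_D[unfolded diag_D0_def])
next
  case (Suc k)
  show ?case
    using Suc.prems unfolding core_F_Suc[of k]
  proof (rule cspan_semilinear_map_into[where f = star and \<sigma> = cnj])
    fix y assume "y \<in> {S e * x * star (S f) | e f x. e \<in> arcs E \<and> f \<in> arcs E \<and> x \<in> F k}"
    then obtain e f x where y: "y = S e * x * star (S f)" "e \<in> arcs E" "f \<in> arcs E" "x \<in> F k"
      by blast
    then have "star y = S f * star x * star (S e)" by (simp add: star_simps mult.assoc)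
    then show "star y \<in> cspan {S e * x * star (S f) | e f x. e \<in> arcs E \<and> f \<in> arcs E \<and> x \<in> F k}"
      using F_gen[OF y(3,2) Suc.IH[OF y(4)]] by (simp add: core_F_Suc)
  qed (simp_all add: star_simps)
qed

lemma F_mult: "x \<in> F k \<Longrightarrow> y \<in> F k \<Longrightarrow> x * y \<in> F k"
proof (induction k arbitrary: x y)
  case 0
  have 1: "P v * y \<in> F 0" if "v \<in> verts E" for v
    using 0(2) unfolding core_F_0 unfolding diag_D0_def
    by (rule cspan_map_into[where f = "\<lambda>y. P v * y"])
      (auto simp: that P_mult_P scaleC_mult algebra_simps complex_vector.span_zero P_in_D[unfolded diag_D0_def])
  show ?case
    using 0(1) unfolding core_F_0 unfolding diag_D0_def
    by (rule cspan_map_into[where f = "\<lambda>x. x * y"])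
      (use 1 in \<open>auto simp: core_F_0 diag_D0_def scaleC_mult algebra_simps\<close>)
next
  case (Suc k)
  have gen: "S e * x' * star (S f) * (S g * y' * star (S h)) \<in> F (Suc k)"
    if "e \<in> arcs E" "f \<in> arcs E" "g \<in> arcs E" "h \<in> arcs E" "x' \<in> F k" "y' \<in> F k" for e f g h x' y'
  proof -
    have "S e * x' * star (S f) * (S g * y' * star (S h)) =
        (if f = g then S e * (x' * (P (head E f) * y')) * star (S h) else 0)"
      using that by (simp add: mult.assoc star_S_S_mult)
    then show ?thesis
      using that by (auto intro!: F_gen Suc.IH P_in_F F_0_mem)
  qed
  show ?case
    using Suc.prems(1)
  proof (rule F_Suc_map_into[where h = "\<lambda>x. x * y"])
    fix e f x' assume *: "e \<in> arcs E" "f \<in> arcs E" "x' \<in> F k"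
    show "S e * x' * star (S f) * y \<in> F (Suc k)"
      using Suc.prems(2)
      by (rule F_Suc_map_into[where h = "\<lambda>y. S e * x' * star (S f) * y"])
        (use gen * in \<open>auto simp: csubspace_F scaleC_mult algebra_simps\<close>)
  qed (simp_all add: csubspace_F scaleC_mult algebra_simps)
qed

lemma F_compress:
  assumes "x \<in> F (Suc k)" "e \<in> arcs E" "f \<in> arcs E"
  shows "star (S e) * x * S f \<in> F k"
  using assms(1)
proof (rule F_Suc_map_into[where h = "\<lambda>x. star (S e) * x * S f"])
  fix g h y assume *: "g \<in> arcs E" "h \<in> arcs E" "y \<in> F k"
  have "star (S e) * (S g * y * star (S h)) * S f =
      (if e = g \<and> h = f then P (head E e) * (y * P (head E f)) else 0)"
    using * assms(2,3) by (simp add: mult.assoc star_S_S_mult star_S_S)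
  then show "star (S e) * (S g * y * star (S h)) * S f \<in> F k"
    using * assms(2,3) by (auto intro!: F_mult P_in_F F_0_mem)
qed (simp_all add: csubspace_F scaleC_mult algebra_simps)

lemma corner_expansion: "x = (\<Sum>e\<in>arcs E. \<Sum>f\<in>arcs E. S e * (star (S e) * x * S f) * star (S f))"
proof -
  have "x = (\<Sum>e\<in>arcs E. S e * star (S e)) * x * (\<Sum>f\<in>arcs E. S f * star (S f))"
    by (simp add: sum_S_star_S)
  then show ?thesis
    by (subst sum.swap) (simp add: sum_distrib_left sum_distrib_right mult.assoc)
qed

section \<open>The shift\<close>

lemma commutant_mult: "x \<in> vertex_commutant \<Longrightarrow> y \<in> vertex_commutant \<Longrightarrow> x * y \<in> vertex_commutant"
  unfolding vertex_commutant_def by (auto simp: mult.assoc) (metis mult.assoc)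

lemma commutant_star:
  assumes "x \<in> vertex_commutant"
  shows "star x \<in> vertex_commutant"
  unfolding vertex_commutant_def
proof (intro CollectI ballI)
  fix v assume v: "v \<in> verts E"
  then have "star (x * P v) = star (P v * x)"
    using assms by (simp add: vertex_commutant_def)
  then show "star x * P v = P v * star x" using v by (simp add: star_simps)
qed

lemma shift_commutant: "\<phi> x \<in> vertex_commutant"
proof -
  have "\<phi> x * P v = P v * \<phi> x" if v: "v \<in> verts E" for v
  proof -
    have "\<phi> x * P v = (\<Sum>e\<in>arcs E. if v = tail E e then S e * x * star (S e) else 0)"
      unfolding shift_def sum_distrib_right
      by (intro sum.cong HOL.refl) (simp add: mult.assoc star_S_P v)
    also have "\<dots> = P v * \<phi> x"
      unfolding shift_def sum_distrib_left
      by (intro sum.cong HOL.refl) (simp add: mult.assoc[symmetric] P_S v)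
    finally show ?thesis .
  qed
  then show ?thesis by (simp add: vertex_commutant_def)
qed

text \<open>
  On the commutant of the vertex projections the shift is implemented by the edges. The commutation
  is needed because \<open>S\<^sub>e\<^sup>* S\<^sub>e\<close> is the projection at the head of \<open>e\<close>, not the unit.
\<close>

lemma shift_S:
  assumes "e \<in> arcs E" "x \<in> vertex_commutant"
  shows "\<phi> x * S e = S e * x"
proof -
  have "\<phi> x * S e = (\<Sum>f\<in>arcs E. if f = e then S e * (x * P (head E e)) else 0)"
    unfolding shift_def sum_distrib_right
    using assms(1) by (intro sum.cong HOL.refl) (simp add: mult.assoc star_S_S)
  also have "\<dots> = S e * (x * P (head E e))"
    using assms(1) by simp
  also have "\<dots> = S e * P (head E e) * x"
    using assms by (simp add: vertex_commutant_def mult.assoc)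
  finally show ?thesis using assms(1) by (simp add: S_P_head)
qed

lemma shift_star: "\<phi> (star x) = star (\<phi> x)"
  by (simp add: shift_def star_simps mult.assoc)

lemma star_S_shift:
  assumes "e \<in> arcs E" "x \<in> vertex_commutant"
  shows "star (S e) * \<phi> x = x * star (S e)"
  using arg_cong[OF shift_S[OF assms(1) commutant_star[OF assms(2)]], of star]
  by (simp add: star_simps shift_star)

lemma shift_mult: "x \<in> vertex_commutant \<Longrightarrow> \<phi> (x * y) = \<phi> x * \<phi> y"
  unfolding shift_def[of E S y] shift_def[of E S "x * y"]
  by (simp add: sum_distrib_left mult.assoc[symmetric] shift_S)

lemma shift_unit [simp]: "\<phi> \<I> = \<I>"
  by (simp add: shift_def sum_S_star_S)

lemma shift_F: "x \<in> F k \<Longrightarrow> \<phi> x \<in> F (Suc k)"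
  unfolding shift_def by (intro F_sum_mem F_gen)

section \<open>Unitaries, cocycles and endomorphisms\<close>

lemma unitaries_iff: "u \<in> \<U> \<longleftrightarrow> u \<in> vertex_commutant \<and> star u * u = \<I> \<and> u * star u = \<I>"
  by (auto simp: graph_unitaries_def unitary_def vertex_commutant_def is_identity_iff)

lemma unitary_commutant: "u \<in> \<U> \<Longrightarrow> u \<in> vertex_commutant"
  by (simp add: unitaries_iff)

lemma unitary_cancel:
  assumes "u \<in> \<U>"
  shows "star u * u = \<I>" "u * star u = \<I>" "star u * (u * x) = x" "u * (star u * x) = x"
  using assms by (simp_all add: unitaries_iff mult.assoc[symmetric])

lemma unit_unitary: "\<I> \<in> \<U>"
  by (simp add: unitaries_iff vertex_commutant_def)

lemma unitary_mult: "u \<in> \<U> \<Longrightarrow> w \<in> \<U> \<Longrightarrow> u * w \<in> \<U>"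
  unfolding unitaries_iff[of "u * w"]
  by (simp add: commutant_mult unitary_commutant star_simps mult.assoc unitary_cancel)

lemma unitary_star: "u \<in> \<U> \<Longrightarrow> star u \<in> \<U>"
  by (simp add: unitaries_iff commutant_star star_simps)

lemma unitary_shift: "u \<in> \<U> \<Longrightarrow> \<phi> u \<in> \<U>"
  by (simp add: unitaries_iff shift_commutant commutant_star flip: shift_star shift_mult)

lemma unitary_shift_pow: "u \<in> \<U> \<Longrightarrow> (\<phi> ^^ m) u \<in> \<U>"
  by (induction m) (simp_all add: unitary_shift)

lemma cocycle_unitary: "u \<in> \<U> \<Longrightarrow> cyc u m \<in> \<U>"
  by (induction m) (simp_all add: unitary_mult unitary_shift_pow unit_unitary flip: unit_elem_def)

text \<open>
  The cocycle is defined by adding factors on the right; splitting off the first factor instead fits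
  the recursion of the core, where edges are added on the outside.
\<close>

lemma cocycle_Suc: "u \<in> \<U> \<Longrightarrow> cyc u (Suc m) = u * \<phi> (cyc u m)"
proof (induction m)
  case 0
  then show ?case by (simp flip: unit_elem_def)
next
  case (Suc m)
  have "cyc u (Suc (Suc m)) = u * (\<phi> (cyc u m) * \<phi> ((\<phi> ^^ m) u))"
    using Suc by (simp add: mult.assoc)
  also have "\<dots> = u * \<phi> (cyc u (Suc m))"
    using Suc.prems by (simp add: shift_mult unitary_commutant cocycle_unitary)
  finally show ?case .
qed

lemma cocycle_F: "u \<in> F k \<Longrightarrow> cyc u m \<in> F (k + m)"
proof (induction m)
  case 0
  then show ?case by (simp add: unit_in_F flip: unit_elem_def)
next
  case (Suc m)
  have "(\<phi> ^^ m) u \<in> F (k + m)"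
    by (induction m) (simp_all add: Suc.prems shift_F)
  with Suc have "cyc u (Suc m) \<in> F (k + m)" by (simp add: F_mult)
  then show ?case using F_mono[of "k + m" "k + Suc m"] by auto
qed

lemma lambda_endo_props:
  assumes "u \<in> \<U>"
  shows "star_hom (lam u)" "v \<in> verts E \<Longrightarrow> lam u (P v) = P v" "e \<in> arcs E \<Longrightarrow> lam u (S e) = u * S e"
    "continuous_on UNIV (lam u)" "lam u \<I> = \<I>"
  using theI'[OF lambda_endo_ex1[OF fin_digraph_axioms graph_algebra assms]]
  unfolding lambda_endo_def[symmetric] by (auto simp: is_identity_iff)

lemma lambda_endo_eqI:
  assumes "u \<in> \<U>" "star_hom h" "continuous_on UNIV h" "h \<I> = \<I>"
    "\<And>v. v \<in> verts E \<Longrightarrow> h (P v) = P v" "\<And>e. e \<in> arcs E \<Longrightarrow> h (S e) = u * S e"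
  shows "h = lam u"
  unfolding lambda_endo_def
  by (rule the1_equality[OF lambda_endo_ex1[OF fin_digraph_axioms graph_algebra assms(1)], symmetric])
    (use assms in \<open>auto simp: is_identity_iff\<close>)

text \<open>
  Applying \<open>\<lambda>\<^sub>u\<close> to \<open>S\<^sub>e x S\<^sub>f\<^sup>*\<close> gives \<open>u S\<^sub>e u\<^sub>k x u\<^sub>k\<^sup>* S\<^sub>f\<^sup>* u\<^sup>*\<close>, and \<open>S\<^sub>e u\<^sub>k = \<phi>(u\<^sub>k) S\<^sub>e\<close> collects the
  outer factors into \<open>u \<phi>(u\<^sub>k) = u\<^sub>k\<^sub>+\<^sub>1\<close>.
\<close>

lemma lambda_endo_F:
  assumes u: "u \<in> \<U>"
  shows "x \<in> F k \<Longrightarrow> lam u x = Ad (cyc u k) x"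
proof (induction k arbitrary: x)
  note hom = star_homD[OF lambda_endo_props(1)[OF u]]
  case 0
  then show ?case
    unfolding core_F_0 unfolding diag_D0_def
    by (rule cspan_eq_on)
      (use lambda_endo_props[OF u] in \<open>auto simp: Ad_def hom scaleC_mult algebra_simps simp flip: unit_elem_def\<close>)
next
  note hom = star_homD[OF lambda_endo_props(1)[OF u]]
  case (Suc k)
  have C: "cyc u k \<in> vertex_commutant" by (simp add: u unitary_commutant cocycle_unitary)
  show ?case
    using Suc.prems unfolding core_F_Suc
  proof (rule cspan_eq_on, safe)
    fix e f x assume *: "e \<in> arcs E" "f \<in> arcs E" "x \<in> F k"
    have "lam u (S e * x * star (S f)) = u * (S e * cyc u k) * x * (star (cyc u k) * star (S f)) * star u"
      using * by (simp add: hom lambda_endo_props[OF u] Suc.IH Ad_def star_simps mult.assoc)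
    also have "S e * cyc u k = \<phi> (cyc u k) * S e"
      using shift_S[OF *(1) C] by simp
    also have "star (cyc u k) * star (S f) = star (S f) * star (\<phi> (cyc u k))"
      using star_S_shift[OF *(2) commutant_star[OF C]] by (simp add: shift_star)
    finally show "lam u (S e * x * star (S f)) = Ad (cyc u (Suc k)) (S e * x * star (S f))"
      unfolding cocycle_Suc[OF u] Ad_def by (simp add: star_simps mult.assoc)
  qed (simp_all add: hom Ad_def scaleC_mult algebra_simps)
qed

text \<open>
  Both elements lie in a common core, where \<open>\<lambda>\<^sub>u\<close> is conjugation by a unitary.
\<close>

lemma lambda_endo_inj_F:
  assumes "u \<in> \<U>" "x \<in> F k" "y \<in> F l" "lam u x = lam u y"
  shows "x = y"
proof -
  let ?w = "cyc u (max k l)"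
  have "x \<in> F (max k l)" "y \<in> F (max k l)"
    using assms F_mono[of k "max k l"] F_mono[of l "max k l"] by auto
  then have "star ?w * (?w * x * star ?w) * ?w = star ?w * (?w * y * star ?w) * ?w"
    using assms by (simp add: lambda_endo_F Ad_def)
  then show ?thesis
    by (simp add: mult.assoc unitary_cancel cocycle_unitary assms(1))
qed

lemma lambda_endo_comp_eq_id:
  assumes "u \<in> \<U>" "w \<in> \<U>" "lam u w * u = \<I>"
  shows "lam u \<circ> lam w = id"
proof -
  note u = lambda_endo_props[OF assms(1)] and w = lambda_endo_props[OF assms(2)]
  note hom = star_homD[OF u(1)] star_homD[OF w(1)]
  have "lam u \<circ> lam w = lam \<I>"
  proof (rule lambda_endo_eqI[OF unit_unitary])
    show "star_hom (lam u \<circ> lam w)" by (simp add: star_hom_def hom)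
    show "continuous_on UNIV (lam u \<circ> lam w)"
      by (rule continuous_on_compose[OF w(4)]) (rule continuous_on_subset[OF u(4)], simp)
  qed (simp_all add: u w hom assms(3) flip: mult.assoc)
  also have "\<dots> = id"
    by (rule lambda_endo_eqI[OF unit_unitary, symmetric]) (simp_all add: star_hom_def)
  finally show ?thesis .
qed

text \<open>
  From \<open>\<lambda>\<^sub>u(w) u S\<^sub>e = S\<^sub>e\<close> for all \<open>e\<close>, because the range projections of the edges sum to the unit.
\<close>

lemma lambda_endo_comp_eq_idD:
  assumes "u \<in> \<U>" "w \<in> \<U>" "\<And>x. lam u (lam w x) = x"
  shows "lam u w = star u"
proof -
  note u = lambda_endo_props[OF assms(1)] and w = lambda_endo_props[OF assms(2)]
  have *: "lam u w * u * (S e * star (S e)) = S e * star (S e)" if "e \<in> arcs E" for e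
    using assms(3)[of "S e"] that by (simp add: u w star_homD[OF u(1)] flip: mult.assoc)
  have "lam u w * u = lam u w * u * (\<Sum>e\<in>arcs E. S e * star (S e))"
    by (simp add: sum_S_star_S)
  also have "\<dots> = \<I>"
    unfolding sum_distrib_left by (simp add: * sum_S_star_S)
  finally have "lam u w * u * star u = star u" by simp
  then show ?thesis by (simp add: mult.assoc unitary_cancel assms(1))
qed

end

section \<open>The four conditions\<close>

text \<open>
  The level is written as \<open>Suc n\<close>, so that the maps \<open>a\<^sub>e\<^sub>f\<close> act on \<open>F n\<close>.
\<close>

locale localized_unitary = graph_cstar E P S
  for E :: "('v, 'e) pre_digraph" and P :: "'v \<Rightarrow> 'a::cstar_algebra" and S :: "'e \<Rightarrow> 'a" +
  fixes u :: 'a and n :: nat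
  assumes u: "u \<in> \<U>" and u_F: "u \<in> F (Suc n)"
begin

abbreviation a :: "'e \<Rightarrow> 'e \<Rightarrow> 'a \<Rightarrow> 'a" where "a \<equiv> a_map S u"
abbreviation \<Xi> :: "nat \<Rightarrow> 'a set" where "\<Xi> \<equiv> Xi_seq E P S (Suc n) u"

lemmas hom_u = star_homD[OF lambda_endo_props(1)[OF u]]

lemma finitely_spanned: "\<exists>B. finite B \<and> F k = cspan B"
proof -
  have "paths E k \<subseteq> verts E \<times> {p. set p \<subseteq> arcs E \<and> length p = k}"
    by (auto simp: paths_def awalk_def)
  then have "finite (paths E k)"
    by (rule finite_subset) (simp add: finite_lists_length_eq)
  then have "finite {path_elem P S \<mu> * star (path_elem P S \<nu>) | \<mu> \<nu>. \<mu> \<in> paths E k \<and> \<nu> \<in> paths E k}"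
    by (intro finite_image_set2) auto
  then show ?thesis unfolding core_F_def by blast
qed

lemma a_add: "a e f (x + y) = a e f x + a e f y" and a_scale: "a e f (c *\<^sub>C x) = c *\<^sub>C a e f x"
  by (simp_all add: a_map_def algebra_simps scaleC_mult)

lemma a_F:
  assumes "e \<in> arcs E" "f \<in> arcs E" "x \<in> F (Suc n)"
  shows "a e f x \<in> F n"
proof -
  have "star u * x * u \<in> F (Suc n)" by (intro F_mult F_star u_F assms)
  then have "star (S e) * (star u * x * u) * S f \<in> F n"
    using assms by (intro F_compress)
  then show ?thesis by (simp add: a_map_def mult.assoc)
qed

lemma a_D:
  assumes "e \<in> arcs E" "f \<in> arcs E" "x \<in> D"
  shows "a e f x \<in> D"
  using assms(3) unfolding diag_D0_def[of E P]
proof (rule cspan_map_into[where f = "a e f"])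
  fix x assume "x \<in> P ` verts E"
  then obtain v where v: "v \<in> verts E" "x = P v" by blast
  have "a e f x = star (S e) * (star u * (P v * u)) * S f"
    by (simp add: a_map_def v mult.assoc)
  also have "P v * u = u * P v"
    using unitary_commutant[OF u] v by (simp add: vertex_commutant_def)
  also have "star (S e) * (star u * (u * P v)) * S f = star (S e) * (P v * S f)"
    by (simp add: unitary_cancel[OF u] mult.assoc)
  also have "\<dots> = (if v = tail E f \<and> e = f then P (head E e) else 0)"
    using assms v by (simp add: P_S star_S_S)
  finally show "a e f x \<in> cspan (P ` verts E)"
    using assms P_in_D by (simp add: complex_vector.span_zero diag_D0_def)
qed (simp_all add: a_add a_scale)

lemma quotient_maps_a: "quotient_maps (F n) D {a e f | e f. e \<in> arcs E \<and> f \<in> arcs E}"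
proof
  fix g x assume g: "g \<in> {a e f | e f. e \<in> arcs E \<and> f \<in> arcs E}"
  show "g x \<in> F n" if "x \<in> F n" using that g F_Suc_mono[of n] by (auto intro: a_F)
  show "g x \<in> D" if "x \<in> D" using that g by (auto intro: a_D)
qed (auto simp: csubspace_F csubspace_D D_subset_F a_add a_scale)

sublocale quot: quotient_maps "F n" D "{a e f | e f. e \<in> arcs E \<and> f \<in> arcs E}"
  by (rule quotient_maps_a)

text \<open>
  Since \<open>\<lambda>\<^sub>u(S\<^sub>e) = u S\<^sub>e\<close>, the products defining \<open>\<Xi>\<close> are, for the spanning \<open>S\<^sub>e\<close>, the values of the maps
  \<open>a\<^sub>e\<^sub>f\<close>; the general ones follow by sesquilinearity.
\<close>

lemma Xi_Suc: "\<Xi> (Suc r) = cspan {a e f x | e f x. e \<in> arcs E \<and> f \<in> arcs E \<and> x \<in> \<Xi> r}" (is "_ = cspan ?B")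
proof (rule antisym)
  have aux: "star (lam u h) * x * lam u h' \<in> cspan ?B"
    if h: "h \<in> cspan (S ` arcs E)" "h' \<in> cspan (S ` arcs E)" and x: "x \<in> \<Xi> r" for h h' x
    using h(1)
  proof (rule cspan_semilinear_map_into[where f = "\<lambda>h. star (lam u h) * x * lam u h'" and \<sigma> = cnj])
    fix s assume "s \<in> S ` arcs E"
    then obtain e where e: "e \<in> arcs E" "s = S e" by blast
    show "star (lam u s) * x * lam u h' \<in> cspan ?B"
      using h(2)
    proof (rule cspan_map_into[where f = "\<lambda>h'. star (lam u s) * x * lam u h'"])
      fix s' assume "s' \<in> S ` arcs E"
      then obtain f where f: "f \<in> arcs E" "s' = S f" by blast
      have "star (lam u s) * x * lam u s' = a e f x"
        using e f by (simp add: lambda_endo_props[OF u] a_map_def star_simps mult.assoc)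
      then show "star (lam u s) * x * lam u s' \<in> cspan ?B"
        using e f x by (auto intro!: complex_vector.span_base)
    qed (simp_all add: hom_u scaleC_mult algebra_simps)
  qed (simp_all add: hom_u scaleC_mult star_simps algebra_simps)
  show "\<Xi> (Suc r) \<subseteq> cspan ?B"
    unfolding Xi_seq.simps
    by (rule complex_vector.span_minimal) (use aux in \<open>auto\<close>)
  have "a e f x \<in> \<Xi> (Suc r)" if "e \<in> arcs E" "f \<in> arcs E" "x \<in> \<Xi> r" for e f x
  proof -
    have "a e f x = star (lam u (S e)) * x * lam u (S f)"
      using that by (simp add: lambda_endo_props[OF u] a_map_def star_simps mult.assoc)
    moreover have "lam u (S e) \<in> lam u ` cspan (S ` arcs E)" "lam u (S f) \<in> lam u ` cspan (S ` arcs E)"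
      using that by (auto intro: complex_vector.span_base)
    ultimately show ?thesis
      unfolding Xi_seq.simps using that(3) by (intro complex_vector.span_base) blast
  qed
  then show "cspan ?B \<subseteq> \<Xi> (Suc r)"
    by (intro complex_vector.span_minimal) auto
qed

lemma Xi_eq_iterated_images: "\<Xi> r = quot.iterated_images r"
proof (induction r)
  case (Suc r)
  have "{a e f x | e f x. e \<in> arcs E \<and> f \<in> arcs E \<and> x \<in> \<Xi> r} =
      {g x | g x. g \<in> {a e f | e f. e \<in> arcs E \<and> f \<in> arcs E} \<and> x \<in> \<Xi> r}"
    by blast
  then show ?case
    unfolding Xi_Suc quot.iterated_images.simps Suc by (rule arg_cong)
qed simp

lemma nilpotent_iff_Xi:
  "nilpotent_rng (L_ring E P S (Suc n)) (A_ring E P S (Suc n) u) \<longleftrightarrow> (\<exists>l. \<Xi> l \<subseteq> D)"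
proof -
  have "{quotient_map (F n) D (a e f) | e f. e \<in> arcs E \<and> f \<in> arcs E} =
      quotient_map (F n) D ` {a e f | e f. e \<in> arcs E \<and> f \<in> arcs E}"
    by blast
  then show ?thesis
    using quot.nilpotent_iff by (simp add: L_ring_def A_ring_def Xi_eq_iterated_images)
qed

text \<open>
  The decreasing spaces \<open>\<Xi>\<^sub>r\<close> are finite-dimensional, so their intersection is one of them.
\<close>

lemma Xi_subset_iff: "Xi E P S (Suc n) u \<subseteq> D \<longleftrightarrow> (\<exists>l. \<Xi> l \<subseteq> D)"
proof
  assume *: "Xi E P S (Suc n) u \<subseteq> D"
  obtain B where B: "finite B" "F n = cspan B" using finitely_spanned by blast
  have "quot.iterated_images 0 \<subseteq> cspan B" unfolding B(2)[symmetric] by simp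
  then have "\<exists>R. \<forall>r\<ge>R. \<Xi> r = \<Xi> R"
    unfolding Xi_eq_iterated_images
    by (rule decreasing_csubspaces_stabilize[where V = quot.iterated_images, OF B(1) _ quot.subspace_iterated_images quot.iterated_images_dec])
  then obtain R where R: "\<And>r. r \<ge> R \<Longrightarrow> \<Xi> r = \<Xi> R" by blast
  have "\<Xi> R \<subseteq> \<Xi> r" for r
  proof (cases "R \<le> r")
    case True
    show ?thesis by (rule equalityD2[OF R[OF True]])
  next
    case False
    then show ?thesis
      using quot.iterated_images_antimono[of r R] by (simp add: Xi_eq_iterated_images)
  qed
  then have "\<Xi> R \<subseteq> Xi E P S (Suc n) u" by (auto simp: Xi_def)
  with * show "\<exists>l. \<Xi> l \<subseteq> D" by blast
qed (auto simp: Xi_def)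

lemma lam_D: "x \<in> D \<Longrightarrow> lam u x = x"
  using lambda_endo_F[OF u, of x 0] by (simp add: core_F_0 Ad_def flip: unit_elem_def)

lemma a_lam: "e \<in> arcs E \<Longrightarrow> f \<in> arcs E \<Longrightarrow> a e f (lam u y) = lam u (star (S e) * y * S f)"
  by (simp add: a_map_def hom_u lambda_endo_props[OF u] star_simps mult.assoc)

text \<open>
  Writing \<open>a\<^sub>e\<^sub>f(x) = \<lambda>\<^sub>u(y\<^sub>e\<^sub>f)\<close>, a preimage of \<open>x\<close> is the sum of the \<open>S\<^sub>e y\<^sub>e\<^sub>f S\<^sub>f\<^sup>*\<close>, because \<open>x\<close> is
  recovered from its compressions by the partial isometries \<open>u S\<^sub>e\<close>.
\<close>

lemma lam_level_Suc:
  assumes "\<And>e f. e \<in> arcs E \<Longrightarrow> f \<in> arcs E \<Longrightarrow> a e f x \<in> lam u ` F l"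
  shows "x \<in> lam u ` F (Suc l)"
proof -
  have "\<exists>y. e \<in> arcs E \<longrightarrow> f \<in> arcs E \<longrightarrow> y \<in> F l \<and> a e f x = lam u y" for e f
    using assms[of e f] by blast
  then obtain y where y: "\<And>e f. e \<in> arcs E \<Longrightarrow> f \<in> arcs E \<Longrightarrow> y e f \<in> F l \<and> a e f x = lam u (y e f)"
    by metis
  let ?y = "\<Sum>e\<in>arcs E. \<Sum>f\<in>arcs E. S e * y e f * star (S f)"
  have "?y \<in> F (Suc l)" using y by (intro F_sum_mem F_gen) auto
  moreover have "lam u ?y = x"
  proof -
    have "lam u ?y = (\<Sum>e\<in>arcs E. \<Sum>f\<in>arcs E. u * (S e * (star (S e) * (star u * x * u) * S f) * star (S f)) * star u)"
      unfolding star_hom_sum[OF lambda_endo_props(1)[OF u]]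
    proof (intro sum.cong HOL.refl)
      fix e f assume "e \<in> arcs E" "f \<in> arcs E"
      then have "lam u (S e * y e f * star (S f)) = u * S e * a e f x * star (u * S f)"
        using y by (simp add: hom_u lambda_endo_props[OF u])
      then show "lam u (S e * y e f * star (S f)) =
          u * (S e * (star (S e) * (star u * x * u) * S f) * star (S f)) * star u"
        by (simp add: a_map_def star_simps mult.assoc)
    qed
    also have "\<dots> = u * (star u * x * u) * star u"
      unfolding corner_expansion[of "star u * x * u", symmetric] sum_distrib_left[symmetric] sum_distrib_right[symmetric] ..
    finally show ?thesis by (simp add: mult.assoc unitary_cancel[OF u])
  qed
  ultimately show ?thesis by blast
qed

text \<open>
  Each application of the maps \<open>a\<^sub>e\<^sub>f\<close> lowers the level by one, since
  \<open>a\<^sub>e\<^sub>f(\<lambda>\<^sub>u(y)) = \<lambda>\<^sub>u(S\<^sub>e\<^sup>* y S\<^sub>f)\<close>.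
\<close>

lemma Xi_subset_lam:
  assumes "F n \<subseteq> lam u ` F l"
  shows "r \<le> l \<Longrightarrow> \<Xi> r \<subseteq> lam u ` F (l - r)"
proof (induction r)
  case 0
  then show ?case using assms by simp
next
  case (Suc r)
  show ?case
    unfolding Xi_Suc
  proof (rule complex_vector.span_minimal[OF _ csubspace_image_star_hom[OF lambda_endo_props(1)[OF u] csubspace_F]], safe)
    fix e f x assume *: "e \<in> arcs E" "f \<in> arcs E" "x \<in> \<Xi> r"
    then obtain y where y: "x = lam u y" "y \<in> F (Suc (l - Suc r))"
      using Suc by (auto simp: Suc_diff_Suc)
    show "a e f x \<in> lam u ` F (l - Suc r)"
      unfolding y(1) a_lam[OF *(1,2)] by (intro imageI F_compress y(2) *)
  qed
qed

text \<open>
  Going back from \<open>\<Xi>\<^sub>l\<close> to \<open>\<Xi>\<^sub>0\<close> raises the level by one at each step.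
\<close>

lemma lam_of_Xi_subset:
  assumes "\<Xi> l \<subseteq> D"
  shows "r \<le> l \<Longrightarrow> \<Xi> (l - r) \<subseteq> lam u ` F r"
proof (induction r)
  case 0
  show ?case
  proof
    fix x assume "x \<in> \<Xi> (l - 0)"
    then have "x \<in> D" using assms by auto
    then show "x \<in> lam u ` F 0" using lam_D[of x] by (metis core_F_0 image_eqI)
  qed
next
  case (Suc r)
  show ?case
  proof
    fix x assume x: "x \<in> \<Xi> (l - Suc r)"
    show "x \<in> lam u ` F (Suc r)"
    proof (rule lam_level_Suc)
      fix e f assume "e \<in> arcs E" "f \<in> arcs E"
      then have "a e f x \<in> \<Xi> (Suc (l - Suc r))"
        unfolding Xi_Suc using x by (intro complex_vector.span_base) blast
      then show "a e f x \<in> lam u ` F r" using Suc by (auto simp: Suc_diff_Suc)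
    qed
  qed
qed

text \<open>
  On the core \<open>\<lambda>\<^sub>u\<close> is conjugation by the cocycle, so the equation can be solved for \<open>w\<close>.
\<close>

lemma preimage_unitary:
  assumes "w \<in> F l" "lam u w = star u"
  shows "w = Ad (star (cyc u l)) (star u)" and "w \<in> \<U>"
proof -
  have "cyc u l * w * star (cyc u l) = star u"
    using lambda_endo_F[OF u assms(1)] assms(2) by (simp add: Ad_def)
  then have "star (cyc u l) * (cyc u l * w * star (cyc u l)) * cyc u l = star (cyc u l) * star u * cyc u l"
    by simp
  then have w: "w = star (cyc u l) * star u * cyc u l"
    by (simp add: mult.assoc unitary_cancel[OF cocycle_unitary[OF u]])
  then show "w = Ad (star (cyc u l)) (star u)" by (simp add: Ad_def star_simps)
  show "w \<in> \<U>" unfolding w by (intro unitary_mult unitary_star cocycle_unitary u)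
qed

lemma lam_lam_preimage:
  assumes "w \<in> F l" "lam u w = star u"
  shows "lam u (lam w x) = x"
proof -
  have "lam u \<circ> lam w = id"
    by (rule lambda_endo_comp_eq_id[OF u preimage_unitary(2)[OF assms]])
      (simp add: assms(2) unitary_cancel[OF u])
  then show ?thesis by (metis comp_apply id_apply)
qed

text \<open>
  If \<open>\<Xi>\<^sub>l \<subseteq> D\<close>, then \<open>F n \<subseteq> \<lambda>\<^sub>u(F l)\<close>, and \<open>u\<^sup>*\<close> lies one level above \<open>F n\<close>. Conversely, \<open>\<lambda>\<^sub>u(w) = u\<^sup>*\<close>
  makes \<open>\<lambda>\<^sub>w\<close> a right inverse of \<open>\<lambda>\<^sub>u\<close> that maps \<open>F n\<close> into a core, as \<open>w\<close> is in a core.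
\<close>

lemma Xi_vanishes_iff: "(\<exists>l. \<Xi> l \<subseteq> D) \<longleftrightarrow> (\<exists>l. star u \<in> lam u ` F l)"
proof
  assume "\<exists>l. \<Xi> l \<subseteq> D"
  then obtain l where "\<Xi> l \<subseteq> D" by blast
  then have sub: "F n \<subseteq> lam u ` F l" using lam_of_Xi_subset[of l l] by simp
  have "star u \<in> lam u ` F (Suc l)"
  proof (rule lam_level_Suc)
    fix e f assume "e \<in> arcs E" "f \<in> arcs E"
    then have "a e f (star u) \<in> F n" by (intro a_F F_star u_F)
    then show "a e f (star u) \<in> lam u ` F l" using sub by blast
  qed
  then show "\<exists>l. star u \<in> lam u ` F l" by blast
next
  assume "\<exists>l. star u \<in> lam u ` F l"
  then obtain w l where w: "w \<in> F l" "lam u w = star u" by (metis imageE)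
  have wU: "w \<in> \<U>" by (rule preimage_unitary(2)[OF w])
  have "F n \<subseteq> lam u ` F (l + n)"
  proof
    fix x assume x: "x \<in> F n"
    then have "x \<in> F (l + n)" using F_mono[of n "l + n"] by auto
    then have "cyc w n * x * star (cyc w n) \<in> F (l + n)"
      by (intro F_mult F_star cocycle_F w(1))
    then have "lam w x \<in> F (l + n)" by (simp add: lambda_endo_F[OF wU x] Ad_def)
    then show "x \<in> lam u ` F (l + n)" using lam_lam_preimage[OF w, of x] by (metis image_eqI)
  qed
  then have "\<Xi> (l + n) \<subseteq> lam u ` F 0" using Xi_subset_lam[of "l + n" "l + n"] by simp
  also have "\<dots> \<subseteq> D" by (auto simp: core_F_0 lam_D)
  finally show "\<exists>l. \<Xi> l \<subseteq> D" by blast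
qed

text \<open>
  All \<open>Ad(u\<^sub>m\<^sup>*)(u\<^sup>*)\<close> lie in cores. Once constant, the sequence also takes its value \<open>w\<close> at an index \<open>l\<close>
  with \<open>w \<in> F l\<close>, where \<open>\<lambda>\<^sub>u = Ad(u\<^sub>l)\<close> undoes the conjugation.
\<close>

lemma stabilizes_iff:
  "(\<exists>M\<ge>1. \<forall>m\<ge>M. Ad (star (cyc u m)) (star u) = Ad (star (cyc u M)) (star u))
    \<longleftrightarrow> (\<exists>l. star u \<in> lam u ` F l)"
proof
  assume "\<exists>M\<ge>1. \<forall>m\<ge>M. Ad (star (cyc u m)) (star u) = Ad (star (cyc u M)) (star u)"
  then obtain M where M: "\<And>m. m \<ge> M \<Longrightarrow> Ad (star (cyc u m)) (star u) = Ad (star (cyc u M)) (star u)"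
    by blast
  define w where "w = Ad (star (cyc u M)) (star u)"
  \<comment> \<open>an index beyond \<open>M\<close> whose core contains the stable value\<close>
  define l where "l = Suc n + M"
  have l: "Suc n \<le> l" "M \<le> l" by (simp_all add: l_def)
  have "cyc u M \<in> F l" using cocycle_F[OF u_F, of M] by (simp add: l_def)
  then have "star (cyc u M) * star u * cyc u M \<in> F l"
    using F_mono[OF l(1)] u_F by (intro F_mult F_star) auto
  then have w: "w \<in> F l" by (simp add: w_def Ad_def star_simps)
  have *: "w = Ad (star (cyc u l)) (star u)" unfolding w_def using M[OF l(2)] by simp
  have "lam u w = Ad (cyc u l) w" by (rule lambda_endo_F[OF u w])
  also have "\<dots> = Ad (cyc u l) (Ad (star (cyc u l)) (star u))" by (rule arg_cong[OF *])
  also have "\<dots> = star u"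
    by (simp add: Ad_def star_simps mult.assoc unitary_cancel[OF cocycle_unitary[OF u]])
  finally have "lam u w = star u" .
  with w show "\<exists>l. star u \<in> lam u ` F l" by (metis image_eqI)
next
  assume "\<exists>l. star u \<in> lam u ` F l"
  then obtain w l where w: "w \<in> F l" "lam u w = star u" by (metis imageE)
  have stable: "Ad (star (cyc u m)) (star u) = w" if "m \<ge> Suc l" for m
    using preimage_unitary(1)[of w m] w F_mono[of l m] that by auto
  then show "\<exists>M\<ge>1. \<forall>m\<ge>M. Ad (star (cyc u m)) (star u) = Ad (star (cyc u M)) (star u)"
  proof (intro exI[of _ "Suc l"] conjI allI impI)
    fix m assume "m \<ge> Suc l"
    then show "Ad (star (cyc u m)) (star u) = Ad (star (cyc u (Suc l))) (star u)"
      unfolding stable[OF order_refl] by (rule stable)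
  qed simp
qed

text \<open>
  The preimage \<open>w\<close> of \<open>u\<^sup>*\<close> gives a right inverse \<open>\<lambda>\<^sub>w\<close> of \<open>\<lambda>\<^sub>u\<close>. It is also a left inverse since
  \<open>\<lambda>\<^sub>w(u) w\<close> is an element of the core with the same image under \<open>\<lambda>\<^sub>u\<close> as the unit.
\<close>

lemma invertible_iff:
  "bij (lam u) \<and> localized E P S (inv_into UNIV (lam u)) \<longleftrightarrow> (\<exists>l. star u \<in> lam u ` F l)"
proof
  assume "bij (lam u) \<and> localized E P S (inv_into UNIV (lam u))"
  then obtain w l where w: "w \<in> F l" "w \<in> \<U>" "inv_into UNIV (lam u) = lam w" and bij: "bij (lam u)"
    by (auto simp: localized_def)
  have "lam u (lam w x) = x" for x
    using bij_is_surj[OF bij] by (simp add: surj_f_inv_f flip: w(3))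
  then have "lam u w = star u" by (rule lambda_endo_comp_eq_idD[OF u w(2)])
  with w(1) show "\<exists>l. star u \<in> lam u ` F l" by (metis image_eqI)
next
  assume "\<exists>l. star u \<in> lam u ` F l"
  then obtain w l where w: "w \<in> F l" "lam u w = star u" by (metis imageE)
  note wU = preimage_unitary(2)[OF w] and right = lam_lam_preimage[OF w]
  let ?l = "l + Suc n"
  have "lam w u = cyc w (Suc n) * u * star (cyc w (Suc n))"
    using lambda_endo_F[OF wU u_F] by (simp add: Ad_def)
  also have "\<dots> \<in> F ?l"
    using F_mono[of "Suc n" ?l] u_F by (intro F_mult F_star cocycle_F w(1)) auto
  finally have "lam w u * w \<in> F ?l"
    using F_mono[of l ?l] w(1) by (intro F_mult) auto
  moreover have "lam u (lam w u * w) = lam u \<I>"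
    by (simp add: hom_u right w(2) lambda_endo_props(5)[OF u] unitary_cancel[OF u])
  ultimately have "lam w u * w = \<I>"
    by (rule lambda_endo_inj_F[OF u _ unit_in_F])
  then have left: "lam w \<circ> lam u = id"
    by (rule lambda_endo_comp_eq_id[OF wU u])
  have right': "lam u \<circ> lam w = id" using right by auto
  have "bij (lam u)" by (rule o_bij[OF left right'])
  moreover have "inv_into UNIV (lam u) = lam w" by (rule inv_unique_comp[OF right' left])
  ultimately show "bij (lam u) \<and> localized E P S (inv_into UNIV (lam u))"
    using w(1) wU by (auto simp: localized_def)
qed

end

theorem theorem5p1:
  fixes E :: "('v, 'e) pre_digraph"
    and P :: "'v \<Rightarrow> 'a::cstar_algebra" and S :: "'e \<Rightarrow> 'a"
    and u :: 'a and k :: nat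
  assumes "fin_digraph E"
    and "\<forall>v\<in>verts E. out_arcs E v \<noteq> {}"
    and "graph_cstar_algebra E P S"
    and "k \<ge> 1"
    and "u \<in> graph_unitaries E P" and "u \<in> core_F E P S k"
  shows
    "((bij (lambda_endo E P S u) \<and> localized E P S (inv_into UNIV (lambda_endo E P S u)))
        \<longleftrightarrow> (\<exists>M\<ge>1. \<forall>m\<ge>M. Ad (star (cocycle E P S u m)) (star u)
                         = Ad (star (cocycle E P S u M)) (star u))) \<and>
     ((\<exists>M\<ge>1. \<forall>m\<ge>M. Ad (star (cocycle E P S u m)) (star u)
                         = Ad (star (cocycle E P S u M)) (star u))
        \<longleftrightarrow> nilpotent_rng (L_ring E P S k) (A_ring E P S k u)) \<and>
     (nilpotent_rng (L_ring E P S k) (A_ring E P S k u)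
        \<longleftrightarrow> Xi E P S k u \<subseteq> diag_D0 E P)"
proof -
  interpret fin_digraph E by (rule assms(1))
  obtain n where k: "k = Suc n" using assms(4) by (cases k) auto
  interpret localized_unitary E P S u n
    using assms by unfold_locales (auto simp: k)
  show ?thesis
    unfolding k nilpotent_iff_Xi Xi_subset_iff Xi_vanishes_iff stabilizes_iff invertible_iff by blast
qed

end
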